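(* Suppose $0\leqslant\alpha<n$, $1<r<p_1$, $1<s<p_2$ and $\frac{rs}{r+s}<p=\frac{p_1p_2}{p_1+p_2}\leqslant q$. For any set of weights \begin{align*} (u,v_1,v_2)\in \bigcup_{\substack{\phi_1\in\mathscr Y_{r,\,B_{p_1,\frac{p_1q}{p}}} \\ \phi_2\in\mathscr Y_{s,\,B_{p_2,\frac{p_2q}{p}}}}}\mathsf A^{[\phi_1,\,\phi_2],\,t^q}_{[p_1,\,p_2],\,q} \end{align*} we have \begin{align*} \|\mathcal{M}_\alpha^{r,s}(f,g)\|_{L^q(u)}\lesssim\|f\|_{L^{p_1}(v_1)}\,\|g\|_{L^{p_2}(v_2)}. \end{align*}
   Context: $\mathcal{M}_\alpha^{r,s}(f,g)(x)=\sup_{Q\ni x}|Q|^{\frac{\alpha}{n}}\left(\frac{1}{|Q|}\int_Q|f|^r\right)^{\frac1r}\left(\frac{1}{|Q|}\int_Q|g|^s\right)^{\frac1s}$, supremum over cubes containing $x$. Weights are non-negative locally integrable functions. A Young function is a convex, continuous, strictly increasing $\Phi:[0,\infty)\to[0,\infty)$ with $\Phi(0)=0$ and $\Phi(t)/t\to\infty$; $\|f\|_{\Phi,Q}=\inf\{\lambda>0:\frac{1}{|Q|}\int_Q\Phi(|f|/\lambda)\le1\}$. $\Phi\in B_{p,q}$ if $\int_c^\infty \Phi(t)^{q/p}t^{-q-1}dt<\infty$ for some $c>0$. $\mathsf A^{[\phi_1,\phi_2],\phi}_{[p_1,p_2],q}$ is the set of triples of weights $(u,v_1,v_2)$ with $\sup_Q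 |Q|^{\frac{\alpha}{n}+\frac1q-\frac1p}\|u^{1/q}\|_{\phi,Q}\|v_1^{-1/p_1}\|_{\phi_1,Q}\|v_2^{-1/p_2}\|_{\phi_2,Q}<\infty$; here $\phi(t)=t^q$, so the $u$-factor is $\left(\frac{1}{|Q|}\int_Q u\right)^{1/q}$. $\mathscr Y_{r,B_{p_1,\frac{p_1q}{p}}}$ is the set of Young functions $\phi_1$ such that $t^{1/r}/\phi_1^{-1}(t)$ is the inverse of a Young function in $B_{p_1,\frac{p_1q}{p}}$; similarly $\mathscr Y_{s,B_{p_2,\frac{p_2q}{p}}}$ with $t^{1/s}/\phi_2^{-1}(t)$ and $B_{p_2,\frac{p_2q}{p}}$. *)

theory Defs
  imports "HOL-Analysis.Analysis"
begin

text \<open>Power of an extended nonnegative real with positive real exponent; infinity stays infinity.\<close>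
definition enn_powr :: "ennreal \<Rightarrow> real \<Rightarrow> ennreal" where
  "enn_powr x a = (if x = \<infinity> then \<infinity> else ennreal (enn2real x powr a))"

definition is_cube :: "'a::euclidean_space set \<Rightarrow> bool" where
  "is_cube Q \<longleftrightarrow> (\<exists>a h. h > 0 \<and> Q = cbox a (a + h *\<^sub>R One))"

abbreviation vol :: "'a::euclidean_space set \<Rightarrow> real" where
  "vol Q \<equiv> measure lebesgue Q"

definition avg :: "'a::euclidean_space set \<Rightarrow> ('a \<Rightarrow> ennreal) \<Rightarrow> ennreal" where
  "avg Q F = ennreal (1 / vol Q) * (\<integral>\<^sup>+ x \<in> Q. F x \<partial>lebesgue)"

definition frac_max :: "real \<Rightarrow> real \<Rightarrow> real \<Rightarrow> ('a::euclidean_space \<Rightarrow> real) \<Rightarrow> ('a \<Rightarrow> real) \<Rightarrow> 'a \<Rightarrow> ennreal" where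
  "frac_max \<alpha> r s f g x =
     (SUP Q \<in> {Q. is_cube Q \<and> x \<in> Q}.
        ennreal (vol Q powr (\<alpha> / real DIM('a)))
        * enn_powr (avg Q (\<lambda>y. ennreal (\<bar>f y\<bar> powr r))) (1 / r)
        * enn_powr (avg Q (\<lambda>y. ennreal (\<bar>g y\<bar> powr s))) (1 / s))"

definition wnorm :: "('a::euclidean_space \<Rightarrow> real) \<Rightarrow> real \<Rightarrow> ('a \<Rightarrow> ennreal) \<Rightarrow> ennreal" where
  "wnorm w p F = enn_powr (\<integral>\<^sup>+ x. enn_powr (F x) p * ennreal (w x) \<partial>lebesgue) (1 / p)"

definition weight :: "('a::euclidean_space \<Rightarrow> real) \<Rightarrow> bool" where
  "weight w \<longleftrightarrow> w \<in> borel_measurable lebesgue \<and> (\<forall>x. 0 \<le> w x)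
     \<and> (\<forall>K. compact K \<longrightarrow> set_integrable lebesgue K w)"

definition young :: "(real \<Rightarrow> real) \<Rightarrow> bool" where
  "young \<Phi> \<longleftrightarrow> convex_on {0..} \<Phi> \<and> continuous_on {0..} \<Phi> \<and> strict_mono_on {0..} \<Phi>
     \<and> \<Phi> 0 = 0 \<and> filterlim (\<lambda>t. \<Phi> t / t) at_top at_top"

text \<open>Inverse of a Young function (a bijection of [0,oo)).\<close>
definition young_inv :: "(real \<Rightarrow> real) \<Rightarrow> real \<Rightarrow> real" where
  "young_inv \<Phi> = the_inv_into {0..} \<Phi>"

definition B_class :: "real \<Rightarrow> real \<Rightarrow> (real \<Rightarrow> real) set" where
  "B_class p q = {\<Phi>. \<exists>c>0. (\<integral>\<^sup>+ t \<in> {c..}. ennreal (\<Phi> t powr (q / p) * t powr (- q - 1)) \<partial>lborel) < \<infinity>}"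

definition Y_class :: "real \<Rightarrow> (real \<Rightarrow> real) set \<Rightarrow> (real \<Rightarrow> real) set" where
  "Y_class r B = {\<phi>. young \<phi> \<and> (\<exists>\<Psi>. young \<Psi> \<and> \<Psi> \<in> B \<and>
       (\<forall>t>0. young_inv \<Psi> t = t powr (1 / r) / young_inv \<phi> t))}"

definition young_ext :: "(real \<Rightarrow> real) \<Rightarrow> ennreal \<Rightarrow> ennreal" where
  "young_ext \<Phi> y = (if y = \<infinity> then \<infinity> else ennreal (\<Phi> (enn2real y)))"

text \<open>Luxemburg norm over a cube of an extended nonnegative function (oo if no lambda works).\<close>
definition lux :: "(real \<Rightarrow> real) \<Rightarrow> 'a::euclidean_space set \<Rightarrow> ('a \<Rightarrow> ennreal) \<Rightarrow> ennreal" where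
  "lux \<Phi> Q F = Inf {ennreal l | l. l > 0 \<and> avg Q (\<lambda>x. young_ext \<Phi> (F x / ennreal l)) \<le> 1}"

definition neg_root :: "('a \<Rightarrow> real) \<Rightarrow> real \<Rightarrow> 'a \<Rightarrow> ennreal" where
  "neg_root v p x = (if v x = 0 then \<infinity> else ennreal (v x powr (- 1 / p)))"

definition A_class :: "real \<Rightarrow> real \<Rightarrow> real \<Rightarrow> real \<Rightarrow> (real \<Rightarrow> real) \<Rightarrow> (real \<Rightarrow> real)
     \<Rightarrow> (('a::euclidean_space \<Rightarrow> real) \<times> ('a \<Rightarrow> real) \<times> ('a \<Rightarrow> real)) set" where
  "A_class \<alpha> p1 p2 q \<phi>1 \<phi>2 = {(u, v1, v2). weight u \<and> weight v1 \<and> weight v2 \<and>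
     (SUP Q \<in> {Q. is_cube Q}.
        ennreal (vol Q powr (\<alpha> / real DIM('a) + 1 / q - 1 / (p1 * p2 / (p1 + p2))))
        * enn_powr (avg Q (\<lambda>x. ennreal (u x))) (1 / q)
        * lux \<phi>1 Q (neg_root v1 p1)
        * lux \<phi>2 Q (neg_root v2 p2)) < \<infinity>}"

end

theory Submission
  imports Defs
begin

text \<open>
  Write \<open>F = \<bar>f\<bar> v\<^sub>1\<^bsup>1/p\<^sub>1\<^esup>\<close>, and let \<open>\<Psi>\<^sub>1\<close> be the Young function in \<open>B\<close> with \<open>\<Psi>\<^sub>1\<^sup>-\<^sup>1 \<phi>\<^sub>1\<^sup>-\<^sup>1 = t\<^bsup>1/r\<^esup>\<close>.
  The generalised Hoelder inequality bounds the \<open>r\<close>-mean of \<open>f\<close> over \<open>Q\<close> by a constant times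
  \<open>\<parallel>F\<parallel>\<^bsub>\<Psi>\<^sub>1,Q\<^esub> \<parallel>v\<^sub>1\<^bsup>-1/p\<^sub>1\<^esup>\<parallel>\<^bsub>\<phi>\<^sub>1,Q\<^esub>\<close>, and likewise for \<open>g\<close>. By the weight condition the contribution of a
  cube \<open>Q\<close> to the integral is at most a constant times \<open>X\<^sub>1(Q)\<^bsup>q/p\<^sub>1\<^esup> X\<^sub>2(Q)\<^bsup>q/p\<^sub>2\<^esup>\<close>, where
  \<open>X\<^sub>1(Q) = \<bar>Q\<bar> \<parallel>F\<parallel>\<^bsub>\<Psi>\<^sub>1,Q\<^esub>\<^bsup>p\<^sub>1\<^esup>\<close>. The one-third trick replaces cubes by finitely many dyadic grids, and principal
  cubes reduce the maximal function to a sparse family. Hoelder's inequality for sums with exponents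
  \<open>p\<^sub>1/p\<close>, \<open>p\<^sub>2/p\<close> separates the factors, so it remains to bound \<open>\<Sum>\<^sub>Q X\<^sub>1(Q)\<^bsup>q/p\<^esup>\<close> by \<open>(\<integral> F\<^bsup>p\<^sub>1\<^esup>)\<^bsup>q/p\<^esup>\<close>.
  A second passage to principal cubes makes \<open>m(Q) = \<parallel>F\<parallel>\<^bsub>\<Psi>\<^sub>1,Q\<^esub> / 2\<close> at least double along chains. Since
  \<open>\<bar>Q\<bar> m(Q)\<^bsup>p\<^sub>1\<^esup>\<close> is at most twice the integral of \<open>F\<^bsup>p\<^sub>1\<^esup> \<eta>(F/m(Q))\<close> over \<open>Q\<close>, where \<open>\<eta>(t) = \<Psi>\<^sub>1(t)/t\<^bsup>p\<^sub>1\<^esup>\<close> for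
  large \<open>t\<close> and \<open>0\<close> otherwise, the sum is controlled pointwise by the sum of \<open>\<eta>\<^bsup>q/p\<^esup>\<close> over a lacunary
  sequence, and this is the integral in the condition \<open>B\<close>.
\<close>

subsection \<open>Powers of extended nonnegative reals\<close>

lemma enn_powr_ennreal: "0 \<le> x \<Longrightarrow> enn_powr (ennreal x) a = ennreal (x powr a)"
  by (simp add: enn_powr_def)

lemma enn_powr_0 [simp]: "enn_powr 0 a = 0"
  by (simp add: enn_powr_def)

lemma enn_powr_top [simp]: "enn_powr top a = top"
  by (simp add: enn_powr_def)

lemma enn_powr_1 [simp]: "enn_powr x 1 = x"
  by (cases x) (auto simp: enn_powr_def)

lemma enn_powr_eq_0_iff [simp]: "enn_powr x a = 0 \<longleftrightarrow> x = 0"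
  by (cases x) (auto simp: enn_powr_def)

lemma enn_powr_eq_top_iff [simp]: "enn_powr x a = top \<longleftrightarrow> x = top"
  by (simp add: enn_powr_def)

lemma enn_powr_mono:
  assumes "x \<le> y" "0 \<le> a"
  shows "enn_powr x a \<le> enn_powr y a"
  using assms by (cases x; cases y) (auto simp: enn_powr_def powr_mono2 top_unique)

lemma enn_powr_mult: "enn_powr (x * y) a = enn_powr x a * enn_powr y a"
proof (cases "x = top \<or> y = top")
  case True
  then show ?thesis
    by (auto simp: ennreal_top_mult ennreal_mult_top)
next
  case False
  then show ?thesis
    by (cases x; cases y) (auto simp: enn_powr_ennreal powr_mult simp flip: ennreal_mult)
qed

lemma enn_powr_powr: "enn_powr (enn_powr x a) b = enn_powr x (a * b)"
  by (cases x) (auto simp: enn_powr_def powr_powr)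

lemma enn_powr_add: "enn_powr x (a + b) = enn_powr x a * enn_powr x b"
  by (cases x) (auto simp: enn_powr_ennreal powr_add ennreal_mult')

lemma enn_powr_SUP_le:
  assumes "0 < q"
  shows "enn_powr (SUP i\<in>I. F i) q \<le> (SUP i\<in>I. enn_powr (F i) q)"
proof -
  define B where "B = (SUP i\<in>I. enn_powr (F i) q)"
  have "F i \<le> enn_powr B (1 / q)" if "i \<in> I" for i
  proof -
    have "enn_powr (enn_powr (F i) q) (1 / q) \<le> enn_powr B (1 / q)"
      unfolding B_def using that assms by (intro enn_powr_mono SUP_upper) auto
    then show ?thesis
      using assms by (simp add: enn_powr_powr)
  qed
  then have "enn_powr (SUP i\<in>I. F i) q \<le> enn_powr (enn_powr B (1 / q)) q"
    using assms by (intro enn_powr_mono SUP_least) auto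
  then show ?thesis
    using assms by (simp add: enn_powr_powr B_def)
qed

lemma borel_measurable_enn_powr [measurable (raw)]:
  assumes [measurable]: "f \<in> borel_measurable M"
  shows "(\<lambda>x. enn_powr (f x) a) \<in> borel_measurable M"
  unfolding enn_powr_def by measurable

subsection \<open>Inequalities of Hoelder and Jensen\<close>

lemma enn_powr_Youngs_inequality:
  assumes exponents: "0 < a" "0 < b" "a + b = 1"
  shows "enn_powr x a * enn_powr y b \<le> ennreal a * x + ennreal b * y"
proof (cases "x = 0 \<or> y = 0 \<or> x = top \<or> y = top")
  case True
  then show ?thesis
    using exponents by (auto simp: ennreal_mult_top)
next
  case False
  then obtain x' y' where finite_pos: "x = ennreal x'" "y = ennreal y'" "0 < x'" "0 < y'"
    by (cases x; cases y) (auto simp: less_le)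
  have "x' powr a * y' powr b \<le> a * x' + b * y'"
    using exponents finite_pos by (intro Youngs_inequality_0) auto
  then have "ennreal (x' powr a * y' powr b) \<le> ennreal (a * x' + b * y')"
    by (rule ennreal_leI)
  then show ?thesis
    using exponents finite_pos by (simp add: enn_powr_ennreal ennreal_mult)
qed

lemma nn_integral_Holder:
  assumes [measurable]: "f \<in> borel_measurable M" "g \<in> borel_measurable M"
    and exponents: "0 < a" "0 < b" "a + b = 1"
  shows "(\<integral>\<^sup>+ x. enn_powr (f x) a * enn_powr (g x) b \<partial>M)
    \<le> enn_powr (\<integral>\<^sup>+ x. f x \<partial>M) a * enn_powr (\<integral>\<^sup>+ x. g x \<partial>M) b"
proof -
  define X Y where "X = (\<integral>\<^sup>+ x. f x \<partial>M)" and "Y = (\<integral>\<^sup>+ x. g x \<partial>M)"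
  consider (zero) "X = 0 \<or> Y = 0" | (top) "X \<noteq> 0" "Y \<noteq> 0" "X = top \<or> Y = top"
    | (finite) "X \<noteq> 0" "Y \<noteq> 0" "X \<noteq> top" "Y \<noteq> top"
    by blast
  then show ?thesis
  proof cases
    case zero
    then have "AE x in M. enn_powr (f x) a * enn_powr (g x) b = 0"
      by (auto simp: X_def Y_def nn_integral_0_iff_AE)
    then have "(\<integral>\<^sup>+ x. enn_powr (f x) a * enn_powr (g x) b \<partial>M) = 0"
      by (simp add: nn_integral_0_iff_AE)
    then show ?thesis
      by simp
  next
    case top
    then show ?thesis
      by (auto simp: X_def [symmetric] Y_def [symmetric] ennreal_top_mult ennreal_mult_top)
  next
    case finite
    have normalise: "z = Z * (z / Z)" if "Z \<noteq> 0" "Z \<noteq> top" for z Z :: ennreal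
      using that mult_divide_eq_ennreal[of Z z] by (simp add: ennreal_times_divide mult.commute)
    have "(\<integral>\<^sup>+ x. enn_powr (f x) a * enn_powr (g x) b \<partial>M)
        = (\<integral>\<^sup>+ x. enn_powr X a * enn_powr Y b * (enn_powr (f x / X) a * enn_powr (g x / Y) b) \<partial>M)"
      using finite normalise[of X] normalise[of Y]
      by (intro nn_integral_cong) (metis enn_powr_mult mult.assoc mult.left_commute)
    also have "\<dots> \<le> (\<integral>\<^sup>+ x. enn_powr X a * enn_powr Y b
        * (ennreal a * (f x / X) + ennreal b * (g x / Y)) \<partial>M)"
      by (intro nn_integral_mono mult_left_mono enn_powr_Youngs_inequality exponents) auto
    also have "\<dots> = enn_powr X a * enn_powr Y b * (ennreal a * (X / X) + ennreal b * (Y / Y))"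
      by (simp add: nn_integral_cmult nn_integral_add nn_integral_divide X_def Y_def)
    also have "\<dots> = enn_powr X a * enn_powr Y b"
      using finite exponents by (simp add: less_top flip: ennreal_plus)
    finally show ?thesis
      by (simp add: X_def Y_def)
  qed
qed

lemma sum_Holder:
  fixes x y :: "'b \<Rightarrow> ennreal"
  assumes "finite S" "0 < a" "0 < b" "a + b = 1"
  shows "(\<Sum>i\<in>S. enn_powr (x i) a * enn_powr (y i) b)
    \<le> enn_powr (\<Sum>i\<in>S. x i) a * enn_powr (\<Sum>i\<in>S. y i) b"
  using nn_integral_Holder[of x "count_space S" y a b] assms
  by (simp add: nn_integral_count_space_finite)

lemma nn_integral_Jensen_powr:
  fixes w h :: "'a \<Rightarrow> ennreal"
  assumes [measurable]: "w \<in> borel_measurable M" "h \<in> borel_measurable M" and "1 \<le> \<theta>"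
  shows "enn_powr (\<integral>\<^sup>+ x. w x * h x \<partial>M) \<theta>
    \<le> enn_powr (\<integral>\<^sup>+ x. w x \<partial>M) (\<theta> - 1) * (\<integral>\<^sup>+ x. w x * enn_powr (h x) \<theta> \<partial>M)"
proof (cases "\<theta> = 1")
  case True
  define W I where "W = (\<integral>\<^sup>+ x. w x \<partial>M)" and "I = (\<integral>\<^sup>+ x. w x * h x \<partial>M)"
  have "W = 0 \<Longrightarrow> I = 0" \<comment> \<open>needed because \<open>0 powr 0 = 0\<close>\<close>
    by (auto simp: W_def I_def nn_integral_0_iff_AE)
  then have "I \<le> enn_powr W 0 * I"
    by (cases W) (auto simp: enn_powr_ennreal ennreal_top_mult)
  with True show ?thesis
    by (simp add: W_def I_def)
next
  case False
  define a b where "a = 1 - 1 / \<theta>" and "b = 1 / \<theta>"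
  have exponents: "0 < a" "0 < b" "a + b = 1" "a * \<theta> = \<theta> - 1" "b * \<theta> = 1" "\<theta> * b = 1"
    using \<open>1 \<le> \<theta>\<close> False by (auto simp: a_def b_def field_simps)
  have "w x * h x = enn_powr (w x) a * enn_powr (w x * enn_powr (h x) \<theta>) b" for x
    using exponents by (simp add: enn_powr_mult enn_powr_powr mult.assoc[symmetric] flip: enn_powr_add)
  then have "(\<integral>\<^sup>+ x. w x * h x \<partial>M)
      \<le> enn_powr (\<integral>\<^sup>+ x. w x \<partial>M) a * enn_powr (\<integral>\<^sup>+ x. w x * enn_powr (h x) \<theta> \<partial>M) b"
    using nn_integral_Holder[of w M "\<lambda>x. w x * enn_powr (h x) \<theta>" a b] exponents by simp
  then have "enn_powr (\<integral>\<^sup>+ x. w x * h x \<partial>M) \<theta>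
      \<le> enn_powr (enn_powr (\<integral>\<^sup>+ x. w x \<partial>M) a * enn_powr (\<integral>\<^sup>+ x. w x * enn_powr (h x) \<theta> \<partial>M) b) \<theta>"
    using \<open>1 \<le> \<theta>\<close> by (intro enn_powr_mono) auto
  then show ?thesis
    using exponents by (simp add: enn_powr_mult enn_powr_powr)
qed

lemma sum_powr_le_powr_sum:
  fixes x :: "'b \<Rightarrow> real"
  assumes "finite S" and "\<And>i. i \<in> S \<Longrightarrow> 0 \<le> x i" and "1 \<le> \<theta>"
  shows "(\<Sum>i\<in>S. x i powr \<theta>) \<le> (\<Sum>i\<in>S. x i) powr \<theta>"
proof -
  define X where "X = (\<Sum>i\<in>S. x i)"
  have le_sum: "x i \<le> X" if "i \<in> S" for i
    unfolding X_def using assms that by (intro member_le_sum) auto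
  have powr_split: "z powr \<theta> = z * z powr (\<theta> - 1)" if "0 \<le> z" for z :: real
    using that by (cases "z = 0") (auto simp: powr_diff)
  have "(\<Sum>i\<in>S. x i powr \<theta>) \<le> (\<Sum>i\<in>S. x i * X powr (\<theta> - 1))"
    using assms le_sum by (intro sum_mono) (auto simp: powr_split intro!: mult_left_mono powr_mono2)
  also have "\<dots> = X powr \<theta>"
    using assms by (subst powr_split) (auto simp: X_def sum_distrib_right intro: sum_nonneg)
  finally show ?thesis
    by (simp add: X_def)
qed

subsection \<open>Laminar, sparse and Carleson families\<close>

definition laminar :: "'a set set \<Rightarrow> bool" where
  "laminar S \<longleftrightarrow> (\<forall>A\<in>S. \<forall>B\<in>S. A \<inter> B = {} \<or> A \<subseteq> B \<or> B \<subseteq> A)"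

lemma laminar_subset: "laminar S \<Longrightarrow> T \<subseteq> S \<Longrightarrow> laminar T"
  unfolding laminar_def by blast

lemma laminarD: "laminar S \<Longrightarrow> A \<in> S \<Longrightarrow> B \<in> S \<Longrightarrow> x \<in> A \<Longrightarrow> x \<in> B \<Longrightarrow> A \<subseteq> B \<or> B \<subseteq> A"
  unfolding laminar_def by blast

lemma laminar_maximal_members:
  assumes "finite S" "laminar S"
  obtains P where "P \<subseteq> S" "disjoint P" "\<Union>P = \<Union>S"
proof
  let ?P = "{Q\<in>S. \<forall>R\<in>S. Q \<subseteq> R \<longrightarrow> Q = R}"
  show "disjoint ?P"
  proof (rule disjointI)
    fix A B assume distinct: "A \<in> ?P" "B \<in> ?P" "A \<noteq> B"
    then have "A \<inter> B = {} \<or> A \<subseteq> B \<or> B \<subseteq> A"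
      using assms(2) by (simp add: laminar_def)
    with distinct show "A \<inter> B = {}"
      by auto
  qed
  have "\<exists>R\<in>?P. Q \<subseteq> R" if "Q \<in> S" for Q
    using finite_has_maximal2[OF assms(1) that] by blast
  then show "\<Union>?P = \<Union>S"
    by blast
qed blast

lemma emeasure_Union_laminar_le:
  assumes S: "finite S" "laminar S" "S \<subseteq> sets M" and sets_N: "sets N = sets M"
    and mass_le: "\<And>Q. Q \<in> S \<Longrightarrow> c * emeasure M Q \<le> emeasure N Q"
  shows "c * emeasure M (\<Union>S) \<le> emeasure N (\<Union>S)"
proof -
  obtain P where P: "P \<subseteq> S" "disjoint P" "\<Union>P = \<Union>S"
    using laminar_maximal_members[OF S(1,2)] by blast
  have additive: "emeasure L (\<Union>S) = (\<Sum>Q\<in>P. emeasure L Q)" if "sets L = sets M" for L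
    using sum_emeasure[of "\<lambda>Q. Q" P L] P S that finite_subset[OF P(1) S(1)]
    by (auto simp: disjoint_family_on_def disjoint_def)
  have "(\<Sum>Q\<in>P. c * emeasure M Q) \<le> (\<Sum>Q\<in>P. emeasure N Q)"
    using mass_le P(1) by (intro sum_mono) blast
  then show ?thesis
    by (simp add: additive sets_N sum_distrib_left)
qed

definition sparse :: "'a measure \<Rightarrow> real \<Rightarrow> 'a set set \<Rightarrow> bool" where
  "sparse M \<delta> S \<longleftrightarrow> (\<forall>R\<in>S. \<delta> * measure M R \<le> measure M (R - \<Union>{Q\<in>S. Q \<subset> R}))"

definition carleson :: "'a measure \<Rightarrow> real \<Rightarrow> 'a set set \<Rightarrow> bool" where
  "carleson M \<Lambda> S \<longleftrightarrow> (\<forall>R\<in>S. (\<Sum>Q\<in>{Q\<in>S. Q \<subseteq> R}. measure M Q) \<le> \<Lambda> * measure M R)"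

lemma carleson_subset:
  assumes "finite S" "carleson M \<Lambda> S" "T \<subseteq> S"
  shows "carleson M \<Lambda> T"
  unfolding carleson_def
proof
  fix R assume "R \<in> T"
  have "(\<Sum>Q\<in>{Q\<in>T. Q \<subseteq> R}. measure M Q) \<le> (\<Sum>Q\<in>{Q\<in>S. Q \<subseteq> R}. measure M Q)"
    using assms by (intro sum_mono2) auto
  also have "\<dots> \<le> \<Lambda> * measure M R"
    using assms \<open>R \<in> T\<close> by (auto simp: carleson_def)
  finally show "(\<Sum>Q\<in>{Q\<in>T. Q \<subseteq> R}. measure M Q) \<le> \<Lambda> * measure M R" .
qed

lemma sparse_imp_carleson:
  assumes S: "finite S" "laminar S" "S \<subseteq> fmeasurable M" and "0 < \<delta>" and sparse: "sparse M \<delta> S"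
  shows "carleson M (1 / \<delta>) S"
  unfolding carleson_def
proof
  fix R assume R: "R \<in> S"
  define E where "E = (\<lambda>Q. Q - \<Union>{Q'\<in>S. Q' \<subset> Q})"
  have disjoint: "disjoint_family_on E {Q\<in>S. Q \<subseteq> R}"
    unfolding disjoint_family_on_def
  proof (intro ballI impI)
    fix Q Q' assume Q: "Q \<in> {Q\<in>S. Q \<subseteq> R}" "Q' \<in> {Q\<in>S. Q \<subseteq> R}" "Q \<noteq> Q'"
    then consider "Q \<inter> Q' = {}" | "Q \<subset> Q'" | "Q' \<subset> Q"
      using S(2) unfolding laminar_def by blast
    then show "E Q \<inter> E Q' = {}"
      by cases (use Q in \<open>auto simp: E_def\<close>)
  qed
  have E_fmeasurable: "E Q \<in> fmeasurable M" if "Q \<in> S" for Q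
    unfolding E_def using that S
    by (intro fmeasurable.Diff fmeasurableD fmeasurable.finite_Union) auto
  have "\<delta> * (\<Sum>Q\<in>{Q\<in>S. Q \<subseteq> R}. measure M Q) \<le> (\<Sum>Q\<in>{Q\<in>S. Q \<subseteq> R}. measure M (E Q))"
    unfolding sum_distrib_left using sparse by (intro sum_mono) (simp add: sparse_def E_def)
  also have "\<dots> = measure M (\<Union>Q\<in>{Q\<in>S. Q \<subseteq> R}. E Q)"
    using S E_fmeasurable disjoint
    by (intro measure_finite_Union[symmetric]) (auto simp: fmeasurableD fmeasurableD2)
  also have "\<dots> \<le> measure M R"
    using R S E_fmeasurable by (intro measure_mono_fmeasurable sets.finite_UN) (auto simp: E_def fmeasurableD)
  finally show "(\<Sum>Q\<in>{Q\<in>S. Q \<subseteq> R}. measure M Q) \<le> 1 / \<delta> * measure M R"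
    using \<open>0 < \<delta>\<close> by (simp add: field_simps)
qed

subsection \<open>Principal subfamilies\<close>

definition principal_subfamily ::
    "('a set \<Rightarrow> 'b::linorder) \<Rightarrow> ('a set \<Rightarrow> 'b) \<Rightarrow> 'a set set \<Rightarrow> 'a set set \<Rightarrow> bool" where
  "principal_subfamily a b S P \<longleftrightarrow> P \<subseteq> S \<and> (\<forall>Q\<in>S. \<exists>R\<in>P. Q \<subseteq> R \<and> a Q \<le> b R)
     \<and> (\<forall>Q\<in>P. \<forall>R\<in>P. Q \<subset> R \<longrightarrow> b R < a Q)"

lemma finite_minimal_induct [consumes 1, case_names empty insert]:
  fixes S :: "'a set set"
  assumes "finite S" and "P {}"
    and insert_minimal: "\<And>Q S. finite S \<Longrightarrow> Q \<notin> S \<Longrightarrow> (\<And>R. R \<in> S \<Longrightarrow> \<not> R \<subset> Q) \<Longrightarrow> P S \<Longrightarrow> P (insert Q S)"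
  shows "P S"
  using \<open>finite S\<close>
proof (induction S rule: finite_psubset_induct)
  case (psubset S)
  show ?case
  proof (cases "S = {}")
    case False
    then obtain Q where Q: "Q \<in> S" "\<forall>R\<in>S. R \<subseteq> Q \<longrightarrow> Q = R"
      using finite_has_minimal[OF psubset.hyps] by auto
    have "P (insert Q (S - {Q}))"
    proof (rule insert_minimal)
      show "P (S - {Q})"
        using Q by (intro psubset.IH) auto
      show "\<not> R \<subset> Q" if "R \<in> S - {Q}" for R
        using Q that by blast
    qed (use psubset.hyps in auto)
    then show ?thesis
      using Q by (simp add: insert_absorb)
  qed (simp add: \<open>P {}\<close>)
qed

lemma principal_subfamily_exists:
  assumes "finite S" "\<And>Q. Q \<in> S \<Longrightarrow> a Q \<le> b Q"
  shows "\<exists>P. principal_subfamily a b S P"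
  using assms
proof (induction S rule: finite_minimal_induct)
  case empty
  show ?case
    by (simp add: principal_subfamily_def)
next
  case (insert Q S)
  then obtain P where P: "P \<subseteq> S" "\<forall>Q\<in>S. \<exists>R\<in>P. Q \<subseteq> R \<and> a Q \<le> b R"
      "\<forall>Q\<in>P. \<forall>R\<in>P. Q \<subset> R \<longrightarrow> b R < a Q"
    by (auto simp: principal_subfamily_def)
  show ?case
  proof (cases "\<exists>R\<in>P. Q \<subseteq> R \<and> a Q \<le> b R")
    case True
    with P have "principal_subfamily a b (insert Q S) P"
      by (auto simp: principal_subfamily_def)
    then show ?thesis ..
  next
    case False
    have "\<not> Q' \<subset> Q" if "Q' \<in> P" for Q'
      using that P(1) insert.hyps(3) by blast
    moreover have "\<forall>R\<in>P. Q \<subset> R \<longrightarrow> b R < a Q"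
      using False by (auto simp: not_le)
    ultimately have "\<forall>Q'\<in>insert Q P. \<forall>R\<in>insert Q P. Q' \<subset> R \<longrightarrow> b R < a Q'"
      using P(3) by simp
    moreover have "\<forall>Q'\<in>insert Q S. \<exists>R\<in>insert Q P. Q' \<subseteq> R \<and> a Q' \<le> b R"
      using P(2) insert.prems by auto
    ultimately have "principal_subfamily a b (insert Q S) (insert Q P)"
      using P(1) by (auto simp: principal_subfamily_def)
    then show ?thesis ..
  qed
qed

subsection \<open>Lacunary sums and the integral condition\<close>

definition lacunary :: "real set \<Rightarrow> bool" where
  "lacunary T \<longleftrightarrow> (\<forall>a\<in>T. 0 < a) \<and> (\<forall>a\<in>T. \<forall>b\<in>T. a < b \<longrightarrow> 2 * a \<le> b)"

definition lacunary_sums_le :: "(real \<Rightarrow> real) \<Rightarrow> real \<Rightarrow> ennreal \<Rightarrow> bool" where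
  "lacunary_sums_le \<eta> \<theta> D
     \<longleftrightarrow> (\<forall>s T. finite T \<and> lacunary T \<and> 0 \<le> s \<longrightarrow> (\<Sum>a\<in>T. ennreal (\<eta> (s / a) powr \<theta>)) \<le> D)"

definition tail_ratio :: "(real \<Rightarrow> real) \<Rightarrow> real \<Rightarrow> real \<Rightarrow> real \<Rightarrow> real" where
  "tail_ratio \<Psi> p c t = (if c < t then \<Psi> t / t powr p else 0)"

definition B_tail :: "(real \<Rightarrow> real) \<Rightarrow> real \<Rightarrow> real \<Rightarrow> real \<Rightarrow> ennreal" where
  "B_tail \<Psi> p q c = (\<integral>\<^sup>+ t\<in>{c..}. ennreal (\<Psi> t powr (q / p) * t powr (- q - 1)) \<partial>lborel)"

lemma borel_measurable_mono_on_nonneg: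
  fixes \<Psi> :: "real \<Rightarrow> real"
  assumes "mono_on {0..} \<Psi>"
  shows "(\<lambda>t. \<Psi> (max 0 t)) \<in> borel_measurable borel"
  using assms by (intro borel_measurable_mono monoI) (auto intro: mono_onD)

lemma borel_measurable_tail_ratio:
  assumes "mono_on {0..} \<Psi>" "0 < c"
  shows "tail_ratio \<Psi> p c \<in> borel_measurable borel"
proof -
  note [measurable] = borel_measurable_mono_on_nonneg[OF assms(1)]
  have "tail_ratio \<Psi> p c = (\<lambda>t. if c < t then \<Psi> (max 0 t) / t powr p else 0)"
    using assms(2) by (auto simp: tail_ratio_def fun_eq_iff)
  then show ?thesis
    by simp
qed

lemma tail_ratio_powr_le_nn_integral:
  assumes mono: "mono_on {0..} \<Psi>" and \<Psi>0_nonneg: "0 \<le> \<Psi> 0" and exponents: "0 < p" "0 < q" and t_pos: "0 < t"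
  shows "ennreal (tail_ratio \<Psi> p c t powr (q / p))
    \<le> ennreal (2 powr (q + 1)) * (\<integral>\<^sup>+ \<tau>\<in>{t..<2 * t}. ennreal (\<Psi> \<tau> powr (q / p) * \<tau> powr (- q - 1)) \<partial>lborel)"
proof -
  define w where "w = \<Psi> t powr (q / p) * (2 * t) powr (- q - 1)"
  have \<Psi>_nonneg: "0 \<le> \<Psi> t"
    using mono_onD[OF mono, of 0 t] \<Psi>0_nonneg t_pos by simp
  have "tail_ratio \<Psi> p c t powr (q / p) \<le> \<Psi> t powr (q / p) * t powr - q"
    using \<Psi>_nonneg t_pos exponents by (simp add: tail_ratio_def powr_divide powr_powr powr_minus divide_simps)
  also have "\<dots> = 2 powr (q + 1) * (w * t)"
  proof -
    have "2 powr (q + 1) * (2 * t) powr (- q - 1) = t powr (- q - 1)"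
      using t_pos by (simp add: powr_mult mult.assoc[symmetric] flip: powr_add)
    moreover have "t powr - q = t powr (- q - 1) * t"
      using t_pos by (simp add: powr_diff)
    ultimately show ?thesis
      unfolding w_def by (metis mult.assoc mult.left_commute)
  qed
  finally have "ennreal (tail_ratio \<Psi> p c t powr (q / p)) \<le> ennreal (2 powr (q + 1)) * ennreal (w * t)"
    by (simp add: ennreal_leI flip: ennreal_mult')
  also have "ennreal (w * t) = (\<integral>\<^sup>+ \<tau>\<in>{t..<2 * t}. ennreal w \<partial>lborel)"
    using t_pos by (subst nn_integral_cmult_indicator) (auto simp: w_def ennreal_mult')
  also have "\<dots> \<le> (\<integral>\<^sup>+ \<tau>\<in>{t..<2 * t}. ennreal (\<Psi> \<tau> powr (q / p) * \<tau> powr (- q - 1)) \<partial>lborel)"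
  proof (rule nn_integral_mono)
    fix \<tau>
    have "w \<le> \<Psi> \<tau> powr (q / p) * \<tau> powr (- q - 1)" if "t \<le> \<tau>" "\<tau> < 2 * t"
      unfolding w_def using that t_pos exponents \<Psi>_nonneg mono_onD[OF mono, of t \<tau>]
      by (intro mult_mono powr_mono2 powr_mono2') auto
    then show "ennreal w * indicator {t..<2 * t} \<tau>
        \<le> ennreal (\<Psi> \<tau> powr (q / p) * \<tau> powr (- q - 1)) * indicator {t..<2 * t} \<tau>"
      by (auto simp: indicator_def intro: ennreal_leI)
  qed
  finally show ?thesis
    by (simp add: mult_left_mono)
qed

lemma sum_nn_set_integral_disjoint_le:
  assumes [measurable]: "W \<in> borel_measurable M" "B \<in> sets M" and "finite T" "disjoint_family_on A T"
    and pieces: "\<And>a. a \<in> T \<Longrightarrow> A a \<in> sets M" "\<And>a. a \<in> T \<Longrightarrow> A a \<subseteq> B"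
  shows "(\<Sum>a\<in>T. \<integral>\<^sup>+ x\<in>A a. W x \<partial>M) \<le> (\<integral>\<^sup>+ x\<in>B. W x \<partial>M)"
proof -
  have "(\<Sum>a\<in>T. \<integral>\<^sup>+ x\<in>A a. W x \<partial>M) = (\<Sum>a\<in>T. emeasure (density M W) (A a))"
    using pieces by (intro sum.cong) (auto simp: emeasure_density)
  also have "\<dots> = emeasure (density M W) (\<Union>a\<in>T. A a)"
    using pieces assms(3,4) by (intro sum_emeasure) auto
  also have "\<dots> \<le> emeasure (density M W) B"
    using pieces by (intro emeasure_mono) auto
  finally show ?thesis
    by (simp add: emeasure_density)
qed

lemma disjoint_family_on_lacunary:
  assumes "lacunary T" "0 \<le> s"
  shows "disjoint_family_on (\<lambda>a. {s / a..<2 * (s / a)}) T"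
proof -
  have "{s / a..<2 * (s / a)} \<inter> {s / b..<2 * (s / b)} = {}" if "a \<in> T" "b \<in> T" "a < b" for a b
  proof -
    have "2 * a \<le> b" "0 < a"
      using that assms(1) by (auto simp: lacunary_def)
    then have "2 * (s / b) \<le> s / a"
      using assms(2) mult_right_mono[of "2 * a" b s] by (simp add: field_simps)
    then show ?thesis
      by auto
  qed
  then show ?thesis
    unfolding disjoint_family_on_def by (metis Int_commute linorder_neqE_linordered_idom)
qed

lemma lacunary_sums_le_tail_ratio:
  assumes mono: "mono_on {0..} \<Psi>" and \<Psi>0_nonneg: "0 \<le> \<Psi> 0" and pos: "0 < p" "0 < q" "0 < c"
  shows "lacunary_sums_le (tail_ratio \<Psi> p c) (q / p) (ennreal (2 powr (q + 1)) * B_tail \<Psi> p q c)"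
  unfolding lacunary_sums_le_def
proof clarify
  fix s :: real and T assume T: "finite T" "lacunary T" and "0 \<le> s"
  define W where "W = (\<lambda>t. ennreal (\<Psi> (max 0 t) powr (q / p) * t powr (- q - 1)))"
  note [measurable] = borel_measurable_mono_on_nonneg[OF mono]
  have W_eq: "(\<integral>\<^sup>+ t\<in>A. ennreal (\<Psi> t powr (q / p) * t powr (- q - 1)) \<partial>lborel) = (\<integral>\<^sup>+ t\<in>A. W t \<partial>lborel)"
    if "A \<subseteq> {0..}" for A
    unfolding W_def using that by (intro nn_integral_cong) (auto simp: indicator_def max_absorb2)
  define T' where "T' = {a\<in>T. c < s / a}"
  have T'_gt: "0 < a" "c < s / a" if "a \<in> T'" for a
    using that T by (auto simp: T'_def lacunary_def)
  have disjoint: "disjoint_family_on (\<lambda>a. {s / a..<2 * (s / a)}) T'"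
    using disjoint_family_on_mono[OF _ disjoint_family_on_lacunary[OF T(2) \<open>0 \<le> s\<close>]] by (auto simp: T'_def)
  have "(\<Sum>a\<in>T. ennreal (tail_ratio \<Psi> p c (s / a) powr (q / p)))
      = (\<Sum>a\<in>T'. ennreal (tail_ratio \<Psi> p c (s / a) powr (q / p)))"
    unfolding T'_def using T(1) by (intro sum.mono_neutral_right) (auto simp: tail_ratio_def)
  also have "\<dots> \<le> (\<Sum>a\<in>T'. ennreal (2 powr (q + 1)) * (\<integral>\<^sup>+ \<tau>\<in>{s / a..<2 * (s / a)}. W \<tau> \<partial>lborel))"
  proof (rule sum_mono)
    fix a assume "a \<in> T'"
    then have "0 < s / a"
      using T'_gt(2)[of a] pos(3) by linarith
    then have "{s / a..<2 * (s / a)} \<subseteq> {0..}"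
      by auto
    then show "ennreal (tail_ratio \<Psi> p c (s / a) powr (q / p))
        \<le> ennreal (2 powr (q + 1)) * (\<integral>\<^sup>+ \<tau>\<in>{s / a..<2 * (s / a)}. W \<tau> \<partial>lborel)"
      using tail_ratio_powr_le_nn_integral[OF mono \<Psi>0_nonneg pos(1,2) \<open>0 < s / a\<close>] by (simp add: W_eq)
  qed
  also have "\<dots> \<le> ennreal (2 powr (q + 1)) * (\<integral>\<^sup>+ \<tau>\<in>{c..}. W \<tau> \<partial>lborel)"
    unfolding sum_distrib_left[symmetric]
  proof (intro mult_left_mono sum_nn_set_integral_disjoint_le disjoint)
    show "{s / a..<2 * (s / a)} \<subseteq> {c..}" if "a \<in> T'" for a
      using T'_gt(2)[OF that] by auto
  qed (use T(1) in \<open>auto simp: W_def T'_def\<close>)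
  also have "(\<integral>\<^sup>+ \<tau>\<in>{c..}. W \<tau> \<partial>lborel) = B_tail \<Psi> p q c"
    unfolding B_tail_def using pos(3) by (subst W_eq) auto
  finally show "(\<Sum>a\<in>T. ennreal (tail_ratio \<Psi> p c (s / a) powr (q / p)))
      \<le> ennreal (2 powr (q + 1)) * B_tail \<Psi> p q c" .
qed

subsection \<open>The Carleson embedding\<close>

lemma carleson_sum_le_principal_sum:
  fixes m :: "'a set \<Rightarrow> real"
  assumes "finite S" and carleson: "carleson M \<Lambda> S" and P: "principal_subfamily m (\<lambda>Q. A * m Q) S P"
    and m: "\<And>Q. Q \<in> S \<Longrightarrow> 0 \<le> m Q" and pos: "0 \<le> \<Lambda>" "0 \<le> A" "0 \<le> p" and \<theta>: "1 \<le> \<theta>"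
  shows "(\<Sum>Q\<in>S. (measure M Q * m Q powr p) powr \<theta>)
    \<le> (\<Lambda> * A powr p) powr \<theta> * (\<Sum>R\<in>P. (measure M R * m R powr p) powr \<theta>)"
proof -
  have "finite P" "P \<subseteq> S"
    using P \<open>finite S\<close> by (auto simp: principal_subfamily_def intro: finite_subset)
  let ?Y = "\<lambda>Q R. (measure M Q * (A * m R) powr p) powr \<theta>"
  have "(\<Sum>Q\<in>S. (measure M Q * m Q powr p) powr \<theta>) \<le> (\<Sum>Q\<in>S. \<Sum>R\<in>P. if Q \<subseteq> R then ?Y Q R else 0)"
  proof (rule sum_mono)
    fix Q assume Q: "Q \<in> S"
    then obtain R where R: "R \<in> P" "Q \<subseteq> R" "m Q \<le> A * m R"
      using P by (auto simp: principal_subfamily_def)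
    then have "(measure M Q * m Q powr p) powr \<theta> \<le> (if Q \<subseteq> R then ?Y Q R else 0)"
      using m[OF Q] pos \<theta> by (auto intro!: powr_mono2 mult_left_mono)
    also have "\<dots> \<le> (\<Sum>R\<in>P. if Q \<subseteq> R then ?Y Q R else 0)"
      using R \<open>finite P\<close> by (intro member_le_sum) auto
    finally show "(measure M Q * m Q powr p) powr \<theta> \<le> (\<Sum>R\<in>P. if Q \<subseteq> R then ?Y Q R else 0)" .
  qed
  also have "\<dots> = (\<Sum>R\<in>P. \<Sum>Q\<in>{Q\<in>S. Q \<subseteq> R}. ?Y Q R)"
    using \<open>finite S\<close> by (subst sum.swap) (simp add: sum.inter_filter)
  also have "\<dots> \<le> (\<Sum>R\<in>P. (\<Lambda> * A powr p) powr \<theta> * (measure M R * m R powr p) powr \<theta>)"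
  proof (rule sum_mono)
    fix R assume "R \<in> P"
    then have R: "R \<in> S" "0 \<le> m R"
      using \<open>P \<subseteq> S\<close> m by auto
    have "(\<Sum>Q\<in>{Q\<in>S. Q \<subseteq> R}. ?Y Q R) \<le> (\<Sum>Q\<in>{Q\<in>S. Q \<subseteq> R}. measure M Q * (A * m R) powr p) powr \<theta>"
      using \<open>finite S\<close> \<theta> by (intro sum_powr_le_powr_sum) auto
    also have "\<dots> \<le> (\<Lambda> * measure M R * (A * m R) powr p) powr \<theta>"
      unfolding sum_distrib_right[symmetric] using carleson R(1) \<theta>
      by (intro powr_mono2 mult_right_mono mult_nonneg_nonneg sum_nonneg) (auto simp: carleson_def)
    also have "\<dots> = (\<Lambda> * A powr p) powr \<theta> * (measure M R * m R powr p) powr \<theta>"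
      using R(2) pos by (simp add: powr_mult mult_ac)
    finally show "(\<Sum>Q\<in>{Q\<in>S. Q \<subseteq> R}. ?Y Q R) \<le> (\<Lambda> * A powr p) powr \<theta> * (measure M R * m R powr p) powr \<theta>" .
  qed
  finally show ?thesis
    by (simp add: sum_distrib_left)
qed

lemma lacunary_principal_scales:
  fixes m :: "'a set \<Rightarrow> real"
  assumes "laminar S" and P: "principal_subfamily m (\<lambda>Q. 2 * m Q) S P" and m: "\<And>Q. Q \<in> P \<Longrightarrow> 0 < m Q"
  shows "inj_on m {R\<in>P. x \<in> R}" and "lacunary (m ` {R\<in>P. x \<in> R})"
proof -
  have chain: "Q = R \<or> 2 * m R < m Q \<or> 2 * m Q < m R"
    if "Q \<in> P" "R \<in> P" "x \<in> Q" "x \<in> R" for Q R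
  proof -
    have "Q \<in> S" "R \<in> S"
      using that P by (auto simp: principal_subfamily_def)
    then have "Q \<subseteq> R \<or> R \<subseteq> Q"
      using laminarD[OF \<open>laminar S\<close>] that by blast
    then consider "Q = R" | "Q \<subset> R" | "R \<subset> Q"
      by blast
    then show ?thesis
      by cases (use P that in \<open>simp_all add: principal_subfamily_def\<close>)
  qed
  show "inj_on m {R\<in>P. x \<in> R}"
  proof (rule inj_onI)
    fix Q R assume "Q \<in> {R\<in>P. x \<in> R}" "R \<in> {R\<in>P. x \<in> R}" "m Q = m R"
    then show "Q = R"
      using chain[of Q R] m[of Q] by auto
  qed
  have "2 * m Q \<le> m R" if "Q \<in> P" "R \<in> P" "x \<in> Q" "x \<in> R" "m Q < m R" for Q R
    using chain[of Q R] m[of Q] that by auto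
  then show "lacunary (m ` {R\<in>P. x \<in> R})"
    using m by (auto simp: lacunary_def)
qed

lemma sum_principal_integrals_le:
  fixes F :: "'a \<Rightarrow> real" and \<eta> :: "real \<Rightarrow> real" and m :: "'a set \<Rightarrow> real"
  assumes S: "finite S" "laminar S" "S \<subseteq> sets M"
    and P: "principal_subfamily m (\<lambda>Q. 2 * m Q) S P" and m: "\<And>Q. Q \<in> P \<Longrightarrow> 0 < m Q"
    and [measurable]: "F \<in> borel_measurable M" "\<eta> \<in> borel_measurable borel"
    and F_nonneg: "\<And>x. 0 \<le> F x"
    and lacunary_bound: "lacunary_sums_le \<eta> \<theta> D"
  shows "(\<Sum>R\<in>P. \<integral>\<^sup>+ x\<in>R. ennreal (F x powr p) * ennreal (\<eta> (F x / m R) powr \<theta>) \<partial>M)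
    \<le> D * (\<integral>\<^sup>+ x. ennreal (F x powr p) \<partial>M)"
proof -
  have P_family: "finite P" "P \<subseteq> sets M"
    using P S by (auto simp: principal_subfamily_def intro: finite_subset)
  then have [measurable]: "R \<in> sets M" if "R \<in> P" for R
    using that by blast
  have overlap: "(\<Sum>R\<in>P. ennreal (\<eta> (F x / m R) powr \<theta>) * indicator R x) \<le> D" for x
  proof -
    note scales = lacunary_principal_scales[OF S(2) P m, of x]
    have "(\<Sum>R\<in>P. ennreal (\<eta> (F x / m R) powr \<theta>) * indicator R x)
        = (\<Sum>R\<in>{R\<in>P. x \<in> R}. ennreal (\<eta> (F x / m R) powr \<theta>))"
      using P_family(1) by (intro sum.mono_neutral_cong_right) auto
    also have "\<dots> = (\<Sum>a\<in>m ` {R\<in>P. x \<in> R}. ennreal (\<eta> (F x / a) powr \<theta>))"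
      by (simp add: sum.reindex[OF scales(1)])
    also have "\<dots> \<le> D"
      using lacunary_bound P_family(1) F_nonneg[of x] scales(2) by (simp add: lacunary_sums_le_def)
    finally show ?thesis .
  qed
  have "(\<Sum>R\<in>P. \<integral>\<^sup>+ x\<in>R. ennreal (F x powr p) * ennreal (\<eta> (F x / m R) powr \<theta>) \<partial>M)
      = (\<integral>\<^sup>+ x. (\<Sum>R\<in>P. ennreal (F x powr p) * (ennreal (\<eta> (F x / m R) powr \<theta>) * indicator R x)) \<partial>M)"
    by (subst nn_integral_sum) (auto simp: mult.assoc)
  also have "\<dots> \<le> (\<integral>\<^sup>+ x. ennreal (F x powr p) * D \<partial>M)"
    unfolding sum_distrib_left[symmetric] using overlap by (intro nn_integral_mono mult_left_mono) auto
  also have "\<dots> = D * (\<integral>\<^sup>+ x. ennreal (F x powr p) \<partial>M)"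
    by (simp add: nn_integral_cmult mult.commute[of _ D])
  finally show ?thesis .
qed

lemma enn_powr_le_of_test:
  fixes F :: "'a \<Rightarrow> real" and \<eta> :: "real \<Rightarrow> real"
  assumes [measurable]: "R \<in> sets M" "F \<in> borel_measurable M" "\<eta> \<in> borel_measurable borel"
    and \<eta>_nonneg: "\<And>t. 0 \<le> \<eta> t" and \<theta>: "1 \<le> \<theta>"
    and test: "X \<le> K * (\<integral>\<^sup>+ x\<in>R. ennreal (F x powr p) * ennreal (\<eta> (F x / m)) \<partial>M)"
  shows "enn_powr X \<theta> \<le> enn_powr K \<theta> * enn_powr (\<integral>\<^sup>+ x. ennreal (F x powr p) \<partial>M) (\<theta> - 1)
    * (\<integral>\<^sup>+ x\<in>R. ennreal (F x powr p) * ennreal (\<eta> (F x / m) powr \<theta>) \<partial>M)"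
proof -
  define N where "N = (\<integral>\<^sup>+ x. ennreal (F x powr p) \<partial>M)"
  define Z where "Z = (\<integral>\<^sup>+ x\<in>R. ennreal (F x powr p) * ennreal (\<eta> (F x / m) powr \<theta>) \<partial>M)"
  define w where "w = (\<lambda>x. ennreal (F x powr p) * indicator R x)"
  have "(\<integral>\<^sup>+ x\<in>R. ennreal (F x powr p) * ennreal (\<eta> (F x / m)) \<partial>M)
      = (\<integral>\<^sup>+ x. w x * ennreal (\<eta> (F x / m)) \<partial>M)"
    by (simp add: w_def mult_ac)
  then have "enn_powr X \<theta> \<le> enn_powr (K * (\<integral>\<^sup>+ x. w x * ennreal (\<eta> (F x / m)) \<partial>M)) \<theta>"
    using test \<theta> by (intro enn_powr_mono) auto
  also have "\<dots> \<le> enn_powr K \<theta> * (enn_powr (\<integral>\<^sup>+ x. w x \<partial>M) (\<theta> - 1)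
      * (\<integral>\<^sup>+ x. w x * enn_powr (ennreal (\<eta> (F x / m))) \<theta> \<partial>M))"
    unfolding enn_powr_mult using \<theta>
    by (intro mult_left_mono nn_integral_Jensen_powr) (auto simp: w_def)
  also have "(\<integral>\<^sup>+ x. w x * enn_powr (ennreal (\<eta> (F x / m))) \<theta> \<partial>M) = Z"
    using \<eta>_nonneg by (simp add: Z_def w_def enn_powr_ennreal mult_ac)
  also have "enn_powr (\<integral>\<^sup>+ x. w x \<partial>M) (\<theta> - 1) \<le> enn_powr N (\<theta> - 1)"
    unfolding N_def using \<theta>
    by (intro enn_powr_mono nn_integral_mono) (auto simp: w_def indicator_def)
  finally show ?thesis
    by (simp add: N_def Z_def mult_left_mono mult_right_mono mult.assoc)
qed

theorem carleson_embedding: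
  fixes F :: "'a \<Rightarrow> real" and \<eta> :: "real \<Rightarrow> real" and m :: "'a set \<Rightarrow> real"
  assumes S: "finite S" "laminar S" "S \<subseteq> sets M" and \<Lambda>: "carleson M \<Lambda> S" "0 \<le> \<Lambda>"
    and m: "\<And>Q. Q \<in> S \<Longrightarrow> 0 < m Q"
    and F [measurable]: "F \<in> borel_measurable M" and F_nonneg: "\<And>x. 0 \<le> F x"
    and \<eta> [measurable]: "\<eta> \<in> borel_measurable borel" and \<eta>_nonneg: "\<And>t. 0 \<le> \<eta> t"
    and lacunary_bound: "lacunary_sums_le \<eta> \<theta> D"
    and p: "0 \<le> p" and \<theta>: "1 \<le> \<theta>"
    and test: "\<And>Q. Q \<in> S \<Longrightarrow> ennreal (measure M Q * m Q powr p)
        \<le> K * (\<integral>\<^sup>+ x\<in>Q. ennreal (F x powr p) * ennreal (\<eta> (F x / m Q)) \<partial>M)"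
  shows "(\<Sum>Q\<in>S. ennreal ((measure M Q * m Q powr p) powr \<theta>))
    \<le> ennreal ((\<Lambda> * 2 powr p) powr \<theta>) * enn_powr K \<theta> * D * enn_powr (\<integral>\<^sup>+ x. ennreal (F x powr p) \<partial>M) \<theta>"
proof -
  define N where "N = (\<integral>\<^sup>+ x. ennreal (F x powr p) \<partial>M)"
  define Z where "Z = (\<lambda>R. \<integral>\<^sup>+ x\<in>R. ennreal (F x powr p) * ennreal (\<eta> (F x / m R) powr \<theta>) \<partial>M)"
  obtain P where P: "principal_subfamily m (\<lambda>Q. 2 * m Q) S P"
    using principal_subfamily_exists[OF S(1), of m "\<lambda>Q. 2 * m Q"] m by force
  then have P_subset: "P \<subseteq> S"
    by (simp add: principal_subfamily_def)
  have local: "ennreal ((measure M R * m R powr p) powr \<theta>) \<le> enn_powr K \<theta> * enn_powr N (\<theta> - 1) * Z R"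
    if "R \<in> P" for R
    using enn_powr_le_of_test[OF _ F \<eta> \<eta>_nonneg \<theta> test, of R] that P_subset S(3)
    by (auto simp: N_def Z_def enn_powr_ennreal)
  have "(\<Sum>Q\<in>S. ennreal ((measure M Q * m Q powr p) powr \<theta>))
      \<le> ennreal ((\<Lambda> * 2 powr p) powr \<theta>) * (\<Sum>R\<in>P. ennreal ((measure M R * m R powr p) powr \<theta>))"
    using carleson_sum_le_principal_sum[OF S(1) \<Lambda>(1) P _ \<Lambda>(2) _ p \<theta>] m
    by (simp add: less_imp_le ennreal_leI flip: ennreal_mult')
  also have "\<dots> \<le> ennreal ((\<Lambda> * 2 powr p) powr \<theta>) * (enn_powr K \<theta> * enn_powr N (\<theta> - 1) * (\<Sum>R\<in>P. Z R))"
    unfolding sum_distrib_left[of "enn_powr K \<theta> * enn_powr N (\<theta> - 1)"]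
    by (intro mult_left_mono sum_mono local) auto
  also have "\<dots> \<le> ennreal ((\<Lambda> * 2 powr p) powr \<theta>) * (enn_powr K \<theta> * enn_powr N (\<theta> - 1) * (D * N))"
    unfolding Z_def N_def using P_subset m
    by (intro mult_left_mono sum_principal_integrals_le[OF S P _ F \<eta> F_nonneg lacunary_bound]) auto
  also have "\<dots> = ennreal ((\<Lambda> * 2 powr p) powr \<theta>) * enn_powr K \<theta> * D * (enn_powr N (\<theta> - 1) * enn_powr N 1)"
    by (simp only: enn_powr_1 mult_ac)
  also have "enn_powr N (\<theta> - 1) * enn_powr N 1 = enn_powr N \<theta>"
    by (simp only: enn_powr_add[symmetric] diff_add_cancel)
  finally show ?thesis
    by (simp add: N_def)
qed

subsection \<open>Averages\<close>

lemma avg_mono: "(\<And>x. x \<in> Q \<Longrightarrow> F x \<le> G x) \<Longrightarrow> avg Q F \<le> avg Q G"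
  unfolding avg_def by (intro mult_left_mono nn_integral_mono) (auto simp: indicator_def)

lemma avg_add:
  assumes [measurable]: "F \<in> borel_measurable lebesgue" "G \<in> borel_measurable lebesgue" "Q \<in> sets lebesgue"
  shows "avg Q (\<lambda>x. F x + G x) = avg Q F + avg Q G"
  unfolding avg_def by (simp add: distrib_right distrib_left nn_integral_add)

lemma avg_cmult:
  assumes [measurable]: "F \<in> borel_measurable lebesgue" "Q \<in> sets lebesgue"
  shows "avg Q (\<lambda>x. c * F x) = c * avg Q F"
  unfolding avg_def by (simp add: mult.assoc nn_integral_cmult mult.left_commute)

lemma avg_const:
  assumes "Q \<in> lmeasurable" "0 < vol Q"
  shows "avg Q (\<lambda>x. c) = c"
proof -
  have "avg Q (\<lambda>x. c) = ennreal (1 / vol Q) * (c * ennreal (vol Q))"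
    using assms unfolding avg_def
    by (subst nn_integral_cmult_indicator) (auto simp: emeasure_eq_measure2 fmeasurableD)
  also have "\<dots> = c * (ennreal (1 / vol Q) * ennreal (vol Q))"
    by (simp add: mult_ac)
  also have "ennreal (1 / vol Q) * ennreal (vol Q) = 1"
    using assms by (simp flip: ennreal_mult')
  finally show ?thesis
    by simp
qed

lemma nn_set_integral_eq_avg:
  assumes "0 < vol Q"
  shows "(\<integral>\<^sup>+ x\<in>Q. F x \<partial>lebesgue) = ennreal (vol Q) * avg Q F"
proof -
  have "ennreal (vol Q) * avg Q F
      = (ennreal (vol Q) * ennreal (1 / vol Q)) * (\<integral>\<^sup>+ x\<in>Q. F x \<partial>lebesgue)"
    by (simp add: avg_def mult.assoc)
  also have "ennreal (vol Q) * ennreal (1 / vol Q) = 1"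
    using assms by (simp flip: ennreal_mult')
  finally show ?thesis
    by simp
qed

subsection \<open>Young functions\<close>

lemma young_strict_mono: "young \<Psi> \<Longrightarrow> 0 \<le> a \<Longrightarrow> a < b \<Longrightarrow> \<Psi> a < \<Psi> b"
  by (auto simp: young_def strict_mono_on_def)

lemma young_mono: "young \<Psi> \<Longrightarrow> 0 \<le> a \<Longrightarrow> a \<le> b \<Longrightarrow> \<Psi> a \<le> \<Psi> b"
  using young_strict_mono[of \<Psi> a b] by (cases "a = b") auto

lemma young_mono_on: "young \<Psi> \<Longrightarrow> mono_on {0..} \<Psi>"
  by (auto intro: mono_onI young_mono)

lemma young_0: "young \<Psi> \<Longrightarrow> \<Psi> 0 = 0"
  by (simp add: young_def)

lemma young_nonneg: "young \<Psi> \<Longrightarrow> 0 \<le> a \<Longrightarrow> 0 \<le> \<Psi> a"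
  using young_mono[of \<Psi> 0 a] by (simp add: young_0)

lemma young_pos: "young \<Psi> \<Longrightarrow> 0 < a \<Longrightarrow> 0 < \<Psi> a"
  using young_strict_mono[of \<Psi> 0 a] by (simp add: young_0)

lemma young_le_divide:
  assumes "young \<Psi>" "0 \<le> t"
  shows "t \<le> 1 + \<Psi> t / \<Psi> 1"
proof (cases "t \<le> 1")
  case True
  have "0 \<le> \<Psi> t / \<Psi> 1"
    using assms by (simp add: young_nonneg)
  with True show ?thesis
    by simp
next
  case False
  have "\<Psi> ((1 - 1 / t) *\<^sub>R 0 + (1 / t) *\<^sub>R t) \<le> (1 - 1 / t) * \<Psi> 0 + 1 / t * \<Psi> t"
    using assms False by (intro convex_onD[of "{0..}"]) (auto simp: young_def)
  then have "t \<le> \<Psi> t / \<Psi> 1"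
    using False assms young_pos[of \<Psi> 1] by (simp add: young_0 field_simps)
  then show ?thesis
    by simp
qed

lemma young_surj:
  assumes "young \<Psi>" "0 \<le> t"
  shows "\<exists>x\<ge>0. \<Psi> x = t"
proof -
  have "eventually (\<lambda>x. t \<le> \<Psi> x / x) at_top"
    using assms(1) by (simp add: young_def filterlim_at_top)
  then obtain b where b_large: "1 \<le> b" "t \<le> \<Psi> b / b"
    using eventually_happens[OF eventually_conj[OF eventually_ge_at_top[of 1]]] by fastforce
  then have "t * 1 \<le> t * b" "t * b \<le> \<Psi> b"
    using assms(2) mult_left_mono[of 1 b t] by (simp_all add: pos_le_divide_eq)
  moreover have "continuous_on {0..b} \<Psi>"
    using assms(1) by (auto simp: young_def intro: continuous_on_subset)
  ultimately show ?thesis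
    using IVT'[of \<Psi> 0 t b] assms b_large by (auto simp: young_0)
qed

lemma young_inv:
  assumes "young \<Psi>" "0 \<le> t"
  shows young_inv_nonneg: "0 \<le> young_inv \<Psi> t" and young_young_inv: "\<Psi> (young_inv \<Psi> t) = t"
proof -
  have inj: "inj_on \<Psi> {0..}"
    using assms by (auto simp: young_def intro: strict_mono_on_imp_inj_on)
  obtain x where x: "0 \<le> x" "\<Psi> x = t"
    using young_surj[OF assms] by auto
  then have "young_inv \<Psi> t = x"
    using the_inv_into_f_f[OF inj, of x] by (simp add: young_inv_def)
  with x show "0 \<le> young_inv \<Psi> t" "\<Psi> (young_inv \<Psi> t) = t"
    by auto
qed

lemma young_inv_pos: "young \<Psi> \<Longrightarrow> 0 < t \<Longrightarrow> 0 < young_inv \<Psi> t"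
  using young_inv[of \<Psi> t] by (auto simp: young_0 less_le)

lemma le_young_inv:
  assumes "young \<Psi>" "0 \<le> a" "\<Psi> a \<le> t"
  shows "a \<le> young_inv \<Psi> t"
proof (rule ccontr)
  assume "\<not> a \<le> young_inv \<Psi> t"
  moreover have "0 \<le> t"
    using assms young_nonneg[of \<Psi> a] by simp
  ultimately show False
    using young_strict_mono[OF assms(1), of "young_inv \<Psi> t" a] young_inv[OF assms(1), of t] assms by auto
qed

lemma borel_measurable_young:
  assumes "young \<Psi>" and [measurable]: "F \<in> borel_measurable M" and "\<And>x. 0 \<le> F x"
  shows "(\<lambda>x. \<Psi> (F x)) \<in> borel_measurable M"
proof -
  note [measurable] = borel_measurable_mono_on_nonneg[OF young_mono_on[OF assms(1)]]
  have "(\<lambda>x. \<Psi> (F x)) = (\<lambda>x. \<Psi> (max 0 (F x)))"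
    using assms(3) by (simp add: max_absorb2)
  then show ?thesis
    by simp
qed

lemma borel_measurable_young_ext:
  assumes "young \<phi>" and [measurable]: "W \<in> borel_measurable M"
  shows "(\<lambda>x. young_ext \<phi> (W x)) \<in> borel_measurable M"
proof -
  have [measurable]: "(\<lambda>x. \<phi> (enn2real (W x))) \<in> borel_measurable M"
    by (rule borel_measurable_young[OF assms(1)]) auto
  show ?thesis
    unfolding young_ext_def by measurable
qed

text \<open>The class provides some lower limit \<open>c\<close>; the embedding needs the one with \<open>\<Psi> c = 1/2\<close>.\<close>

lemma B_tail_finite:
  assumes \<Psi>: "young \<Psi>" "\<Psi> \<in> B_class p q" and pq: "0 < p" "0 < q" and c_pos: "0 < c"
  shows "B_tail \<Psi> p q c < \<infinity>"
proof -
  define W where "W t = ennreal (\<Psi> t powr (q / p) * t powr (- q - 1))" for t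
  obtain d where tail_finite: "0 < d" "B_tail \<Psi> p q d < \<infinity>"
    using \<Psi>(2) by (auto simp: B_class_def B_tail_def)
  define A where "A = \<Psi> d powr (q / p) * c powr (- q - 1)"
  have W_le: "W t \<le> ennreal A" if "c \<le> t" "t \<le> d" for t
    unfolding W_def A_def using that pq c_pos young_nonneg[OF \<Psi>(1), of t] young_mono[OF \<Psi>(1), of t d]
    by (intro ennreal_leI mult_mono powr_mono2 powr_mono2') auto
  have "B_tail \<Psi> p q c \<le> (\<integral>\<^sup>+ t. ennreal A * indicator {c..d} t + W t * indicator {d..} t \<partial>lborel)"
    unfolding B_tail_def W_def[symmetric] using W_le
    by (intro nn_integral_mono) (auto simp: indicator_def)
  also have "\<dots> = (\<integral>\<^sup>+ t. ennreal A * indicator {c..d} t \<partial>lborel) + (\<integral>\<^sup>+ t. W t * indicator {d..} t \<partial>lborel)"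
  proof (rule nn_integral_add)
    note [measurable] = borel_measurable_mono_on_nonneg[OF young_mono_on[OF \<Psi>(1)]]
    have "(\<lambda>t. W t * indicator {d..} t)
        = (\<lambda>t. ennreal (\<Psi> (max 0 t) powr (q / p) * t powr (- q - 1)) * indicator {d..} t)"
      using tail_finite(1) by (auto simp: W_def indicator_def fun_eq_iff max_absorb2)
    then show "(\<lambda>t. W t * indicator {d..} t) \<in> borel_measurable lborel"
      by simp
  qed simp
  also have "\<dots> < \<infinity>"
    using tail_finite(2)
    by (auto simp: B_tail_def W_def nn_integral_cmult_indicator ennreal_mult_less_top
        emeasure_lborel_Icc_eq)
  finally show ?thesis .
qed

subsection \<open>Luxemburg norms\<close>

lemma avg_gt_one_of_less_lux:
  assumes "0 < m" "ennreal m < lux \<Psi> Q F"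
  shows "1 < avg Q (\<lambda>x. young_ext \<Psi> (F x / ennreal m))"
proof (rule ccontr)
  assume "\<not> 1 < avg Q (\<lambda>x. young_ext \<Psi> (F x / ennreal m))"
  then have "lux \<Psi> Q F \<le> ennreal m"
    unfolding lux_def using assms(1) by (intro Inf_lower) (auto simp: not_less)
  with assms(2) show False
    by simp
qed

lemma le_mult_lux:
  assumes c_finite: "0 < c" "c < \<infinity>"
    and admissible_le: "\<And>l. 0 < l \<Longrightarrow> avg Q (\<lambda>x. young_ext \<Psi> (F x / ennreal l)) \<le> 1 \<Longrightarrow> X \<le> c * ennreal l"
  shows "X \<le> c * lux \<Psi> Q F"
proof -
  have "X / c \<le> lux \<Psi> Q F"
    unfolding lux_def
  proof (rule Inf_greatest, clarify)
    fix l :: real assume "0 < l" "avg Q (\<lambda>x. young_ext \<Psi> (F x / ennreal l)) \<le> 1"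
    then show "X / c \<le> ennreal l"
      using admissible_le c_finite by (intro divide_le_posI_ennreal) (auto simp: mult.commute)
  qed
  then have "c * (X / c) \<le> c * lux \<Psi> Q F"
    by (rule mult_left_mono) simp
  moreover have "c * (X / c) = X"
    using c_finite mult_divide_eq_ennreal[of c X] by (simp add: ennreal_times_divide mult.commute)
  ultimately show ?thesis
    by simp
qed

lemma avg_le_lux:
  fixes W :: "'a::euclidean_space \<Rightarrow> ennreal"
  assumes \<phi>: "young \<phi>" and Q: "Q \<in> lmeasurable" "0 < vol Q"
    and W [measurable]: "W \<in> borel_measurable lebesgue"
  shows "avg Q W \<le> ennreal (1 + 1 / \<phi> 1) * lux \<phi> Q W"
proof (rule le_mult_lux)
  have \<phi>1_pos: "0 < \<phi> 1"
    using young_pos[OF \<phi>] by simp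
  then show "0 < ennreal (1 + 1 / \<phi> 1)"
    by (simp add: add_pos_pos)
  fix l :: real assume admissible: "0 < l" "avg Q (\<lambda>x. young_ext \<phi> (W x / ennreal l)) \<le> 1"
  have [measurable]: "Q \<in> sets lebesgue" "(\<lambda>x. young_ext \<phi> (W x / ennreal l)) \<in> borel_measurable lebesgue"
    using Q by (auto intro: borel_measurable_young_ext[OF \<phi>])
  have "avg Q W \<le> avg Q (\<lambda>x. ennreal l * (1 + ennreal (1 / \<phi> 1) * young_ext \<phi> (W x / ennreal l)))"
  proof (rule avg_mono)
    fix x
    show "W x \<le> ennreal l * (1 + ennreal (1 / \<phi> 1) * young_ext \<phi> (W x / ennreal l))"
    proof (cases "W x")
      case (real w)
      have "w \<le> l * (1 + 1 / \<phi> 1 * \<phi> (w / l))"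
        using young_le_divide[OF \<phi>, of "w / l"] real admissible(1) by (simp add: field_simps)
      moreover have "0 \<le> \<phi> (w / l)"
        using young_nonneg[OF \<phi>] real admissible(1) by simp
      ultimately show ?thesis
        using real admissible(1) \<phi>1_pos
        by (simp add: young_ext_def divide_ennreal
            flip: ennreal_mult' ennreal_1 ennreal_plus del: ennreal_1)
    next
      case top
      then show ?thesis
        using admissible(1) \<phi>1_pos by (simp add: young_ext_def ennreal_top_divide ennreal_mult_top)
    qed
  qed
  also have "\<dots> = ennreal l * (1 + ennreal (1 / \<phi> 1) * avg Q (\<lambda>x. young_ext \<phi> (W x / ennreal l)))"
    using avg_const[OF Q] by (simp add: avg_cmult avg_add)
  also have "\<dots> \<le> ennreal l * (1 + ennreal (1 / \<phi> 1) * 1)"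
    using admissible by (intro mult_left_mono add_left_mono) auto
  also have "\<dots> = ennreal (1 + 1 / \<phi> 1) * ennreal l"
    using \<phi>1_pos by (simp add: mult.commute ennreal_plus)
  finally show "avg Q W \<le> ennreal (1 + 1 / \<phi> 1) * ennreal l" .
qed simp

lemma lux_pos:
  fixes W :: "'a::euclidean_space \<Rightarrow> ennreal"
  assumes \<phi>: "young \<phi>" and Q: "Q \<in> lmeasurable" "0 < vol Q"
    and W [measurable]: "W \<in> borel_measurable lebesgue" and "\<And>x. 0 < W x"
  shows "0 < lux \<phi> Q W"
proof (rule ccontr)
  assume "\<not> 0 < lux \<phi> Q W"
  then have "avg Q W = 0"
    using avg_le_lux[OF \<phi> Q W] by (simp add: zero_less_iff_neq_zero)
  then have "(\<integral>\<^sup>+ x\<in>Q. W x \<partial>lebesgue) = 0"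
    by (simp add: nn_set_integral_eq_avg[OF Q(2)])
  moreover have [measurable]: "Q \<in> sets lebesgue"
    using Q by auto
  ultimately have "AE x in lebesgue. W x * indicator Q x = 0"
    by (simp add: nn_integral_0_iff_AE)
  then have "AE x in lebesgue. x \<notin> Q"
    using assms(5) by (auto simp: zero_less_iff_neq_zero)
  then have "Q \<in> null_sets lebesgue"
    by (simp add: AE_iff_null_sets)
  with Q(2) show False
    by (simp add: measure_eq_0_null_sets)
qed

subsection \<open>The Carleson embedding for Luxemburg norms\<close>

lemma young_le_tail_ratio:
  assumes \<Psi>: "young \<Psi>" and "0 < c" "0 < m" "0 \<le> y"
  shows "\<Psi> (y / m) \<le> \<Psi> c + m powr - p * (y powr p * tail_ratio \<Psi> p c (y / m))"
proof (cases "c < y / m")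
  case True
  then have "0 < y"
    using assms by (cases "y = 0") auto
  then have "m powr - p * (y powr p * tail_ratio \<Psi> p c (y / m)) = \<Psi> (y / m)"
    using True assms(3) by (simp add: tail_ratio_def powr_divide powr_minus divide_simps)
  then show ?thesis
    using young_nonneg[OF \<Psi>, of c] assms(2) by simp
next
  case False
  then show ?thesis
    using young_mono[OF \<Psi>, of "y / m" c] assms by (simp add: tail_ratio_def)
qed

lemma vol_powr_le_tail_ratio_integral:
  fixes F :: "'a::euclidean_space \<Rightarrow> real"
  assumes \<Psi>: "young \<Psi>" and F [measurable]: "F \<in> borel_measurable lebesgue" and F_nonneg: "\<And>x. 0 \<le> F x"
    and level: "0 < c" "\<Psi> c \<le> 1 / 2" and Q: "Q \<in> lmeasurable" "0 < vol Q"
    and m: "0 < m" "ennreal m < lux \<Psi> Q (\<lambda>x. ennreal (F x))"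
  shows "ennreal (vol Q * m powr p)
    \<le> 2 * (\<integral>\<^sup>+ x\<in>Q. ennreal (F x powr p) * ennreal (tail_ratio \<Psi> p c (F x / m)) \<partial>lebesgue)"
proof -
  define G where "G x = F x powr p * tail_ratio \<Psi> p c (F x / m)" for x
  note [measurable] = borel_measurable_tail_ratio[OF young_mono_on[OF \<Psi>] level(1)]
  have [measurable]: "Q \<in> sets lebesgue"
    using Q by auto
  have [measurable]: "G \<in> borel_measurable lebesgue"
    unfolding G_def by measurable
  have G_nonneg: "0 \<le> G x" for x
    using young_nonneg[OF \<Psi>] F_nonneg[of x] m(1) by (simp add: G_def tail_ratio_def)
  have \<Psi>_le: "\<Psi> (F x / m) \<le> 1 / 2 + m powr - p * G x" for x
    using young_le_tail_ratio[OF \<Psi> level(1) m(1) F_nonneg, of x p] level(2) by (simp add: G_def)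
  have "1 < avg Q (\<lambda>x. young_ext \<Psi> (ennreal (F x) / ennreal m))"
    using m by (rule avg_gt_one_of_less_lux)
  also have "\<dots> \<le> avg Q (\<lambda>x. ennreal (1 / 2) + ennreal (m powr - p) * ennreal (G x))"
    using \<Psi>_le G_nonneg F_nonneg m(1)
    by (intro avg_mono)
      (simp add: young_ext_def divide_ennreal ennreal_leI flip: ennreal_mult' ennreal_plus del: ennreal_half)
  also have "\<dots> = ennreal (1 / 2) + ennreal (m powr - p) * avg Q G"
    using avg_const[OF Q] by (simp add: avg_add avg_cmult del: ennreal_half)
  finally have avg_gt: "1 < ennreal (1 / 2) + ennreal (m powr - p) * avg Q G" .
  have "ennreal (m powr p) \<le> 2 * avg Q G"
  proof (cases "avg Q G")
    case (real b)
    then have "1 < 1 / 2 + m powr - p * b"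
      using avg_gt by (simp flip: ennreal_mult' ennreal_plus del: ennreal_half)
    then have "m powr p \<le> 2 * b"
      using m(1) by (simp add: powr_minus field_simps)
    then show ?thesis
      using real by (simp add: numeral_mult_ennreal ennreal_leI)
  qed (simp add: ennreal_mult_top)
  then have "ennreal (vol Q) * ennreal (m powr p) \<le> ennreal (vol Q) * (2 * avg Q G)"
    by (rule mult_left_mono) simp
  also have "\<dots> = 2 * (\<integral>\<^sup>+ x\<in>Q. ennreal (G x) \<partial>lebesgue)"
    by (simp add: nn_set_integral_eq_avg[OF Q(2)] mult_ac)
  finally show ?thesis
    by (simp add: G_def ennreal_mult')
qed

definition embedding_const :: "(real \<Rightarrow> real) \<Rightarrow> real \<Rightarrow> real \<Rightarrow> real \<Rightarrow> ennreal" where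
  "embedding_const \<Psi> p q \<Lambda> = ennreal ((\<Lambda> * 2 powr p) powr (q / p)) * enn_powr 2 (q / p)
     * (ennreal (2 powr (q + 1)) * B_tail \<Psi> p q (young_inv \<Psi> (1 / 2)))"

lemma embedding_const_finite:
  assumes "young \<Psi>" "\<Psi> \<in> B_class p q" "0 < p" "0 < q"
  shows "embedding_const \<Psi> p q \<Lambda> < \<infinity>"
  using B_tail_finite[OF assms young_inv_pos[OF assms(1), of "1 / 2"]]
  by (auto simp: embedding_const_def ennreal_mult_eq_top_iff less_top[symmetric])

lemma sum_below_lux_le:
  fixes F :: "'a::euclidean_space \<Rightarrow> real"
  assumes \<Psi>: "young \<Psi>" and pq: "0 < p" "p \<le> q"
    and S: "finite S" "laminar S" "\<And>Q. Q \<in> S \<Longrightarrow> Q \<in> lmeasurable" "\<And>Q. Q \<in> S \<Longrightarrow> 0 < vol Q"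
    and \<Lambda>: "carleson lebesgue \<Lambda> S" "0 \<le> \<Lambda>"
    and F: "F \<in> borel_measurable lebesgue" "\<And>x. 0 \<le> F x"
    and m: "\<And>Q. Q \<in> S \<Longrightarrow> 0 < m Q" "\<And>Q. Q \<in> S \<Longrightarrow> ennreal (m Q) < lux \<Psi> Q (\<lambda>x. ennreal (F x))"
  shows "(\<Sum>Q\<in>S. ennreal ((vol Q * m Q powr p) powr (q / p)))
    \<le> embedding_const \<Psi> p q \<Lambda> * enn_powr (\<integral>\<^sup>+ x. ennreal (F x powr p) \<partial>lebesgue) (q / p)"
proof -
  define c where "c = young_inv \<Psi> (1 / 2)"
  have level: "0 < c" "\<Psi> c \<le> 1 / 2"
    using young_inv_pos[OF \<Psi>, of "1 / 2"] young_young_inv[OF \<Psi>, of "1 / 2"] by (auto simp: c_def)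
  note mono = young_mono_on[OF \<Psi>]
  show ?thesis
    unfolding embedding_const_def c_def[symmetric]
  proof (rule carleson_embedding[OF S(1,2) _ \<Lambda> m(1) F borel_measurable_tail_ratio[OF mono level(1)]])
    show "0 \<le> tail_ratio \<Psi> p c t" for t
      using young_nonneg[OF \<Psi>, of t] level(1) by (simp add: tail_ratio_def)
    show "lacunary_sums_le (tail_ratio \<Psi> p c) (q / p) (ennreal (2 powr (q + 1)) * B_tail \<Psi> p q c)"
      using pq level(1) young_0[OF \<Psi>] by (intro lacunary_sums_le_tail_ratio mono) auto
    show "ennreal (vol Q * m Q powr p)
        \<le> 2 * (\<integral>\<^sup>+ x\<in>Q. ennreal (F x powr p) * ennreal (tail_ratio \<Psi> p c (F x / m Q)) \<partial>lebesgue)"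
      if "Q \<in> S" for Q
      using S(3,4) m that by (intro vol_powr_le_tail_ratio_integral[OF \<Psi> F level]) auto
  qed (use S(3) pq in auto)
qed

lemma lux_finite:
  fixes F :: "'a::euclidean_space \<Rightarrow> real"
  assumes \<Psi>: "young \<Psi>" "\<Psi> \<in> B_class p q" and pq: "0 < p" "p \<le> q" and Q: "Q \<in> lmeasurable" "0 < vol Q"
    and F: "F \<in> borel_measurable lebesgue" "\<And>x. 0 \<le> F x"
    and integral_finite: "(\<integral>\<^sup>+ x. ennreal (F x powr p) \<partial>lebesgue) < \<infinity>"
  shows "lux \<Psi> Q (\<lambda>x. ennreal (F x)) < \<infinity>"
proof (rule ccontr)
  assume "\<not> lux \<Psi> Q (\<lambda>x. ennreal (F x)) < \<infinity>"
  then have lux_top: "lux \<Psi> Q (\<lambda>x. ennreal (F x)) = top"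
    by (simp add: less_top[symmetric])
  define K where "K = embedding_const \<Psi> p q 1 * enn_powr (\<integral>\<^sup>+ x. ennreal (F x powr p) \<partial>lebesgue) (q / p)"
  have "K < \<infinity>"
    using embedding_const_finite[OF \<Psi>] pq integral_finite
    by (simp add: K_def ennreal_mult_eq_top_iff less_top[symmetric])
  then obtain B where B: "K = ennreal B" "0 \<le> B"
    by (cases K) auto
  define m where "m = ((B + 1) powr (p / q) / vol Q) powr (1 / p)"
  have m_pos: "0 < m"
    using B Q by (simp add: m_def)
  have "(vol Q * m powr p) powr (q / p) = B + 1"
    using B Q pq by (simp add: m_def powr_powr)
  moreover have "(\<Sum>Q'\<in>{Q}. ennreal ((vol Q' * m powr p) powr (q / p))) \<le> K"
    unfolding K_def using Q m_pos lux_top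
    by (intro sum_below_lux_le[OF \<Psi>(1) pq _ _ _ _ _ _ F])
      (auto simp: laminar_def carleson_def cong: conj_cong)
  ultimately show False
    using B by simp
qed

theorem sum_lux_le:
  fixes F :: "'a::euclidean_space \<Rightarrow> real"
  assumes \<Psi>: "young \<Psi>" "\<Psi> \<in> B_class p q" and pq: "0 < p" "p \<le> q"
    and S: "finite S" "laminar S" "\<And>Q. Q \<in> S \<Longrightarrow> Q \<in> lmeasurable" "\<And>Q. Q \<in> S \<Longrightarrow> 0 < vol Q"
    and \<Lambda>: "carleson lebesgue \<Lambda> S" "0 \<le> \<Lambda>"
    and F: "F \<in> borel_measurable lebesgue" "\<And>x. 0 \<le> F x"
    and integral_finite: "(\<integral>\<^sup>+ x. ennreal (F x powr p) \<partial>lebesgue) < \<infinity>"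
  shows "(\<Sum>Q\<in>S. enn_powr (ennreal (vol Q) * enn_powr (lux \<Psi> Q (\<lambda>x. ennreal (F x))) p) (q / p))
    \<le> ennreal (2 powr q) * embedding_const \<Psi> p q \<Lambda>
        * enn_powr (\<integral>\<^sup>+ x. ennreal (F x powr p) \<partial>lebesgue) (q / p)"
proof -
  define L where "L Q = lux \<Psi> Q (\<lambda>x. ennreal (F x))" for Q
  define S' where "S' = {Q\<in>S. L Q \<noteq> 0}"
  define m where "m Q = enn2real (L Q) / 2" for Q
  have "S' \<subseteq> S"
    by (auto simp: S'_def)
  note S' = finite_subset[OF this S(1)] laminar_subset[OF S(2) this] carleson_subset[OF S(1) \<Lambda>(1) this]
  have m: "0 < m Q" "L Q = ennreal (2 * m Q)" if "Q \<in> S'" for Q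
    using that lux_finite[OF \<Psi> pq S(3,4) F integral_finite, of Q]
    by (auto simp: S'_def m_def L_def enn2real_positive_iff zero_less_iff_neq_zero)
  have "(\<Sum>Q\<in>S. enn_powr (ennreal (vol Q) * enn_powr (L Q) p) (q / p))
      = (\<Sum>Q\<in>S'. enn_powr (ennreal (vol Q) * enn_powr (L Q) p) (q / p))"
    unfolding S'_def using S(1) by (intro sum.mono_neutral_right) auto
  also have "\<dots> = (\<Sum>Q\<in>S'. ennreal (2 powr q) * ennreal ((vol Q * m Q powr p) powr (q / p)))"
  proof (intro sum.cong refl)
    fix Q assume "Q \<in> S'"
    then show "enn_powr (ennreal (vol Q) * enn_powr (L Q) p) (q / p)
        = ennreal (2 powr q) * ennreal ((vol Q * m Q powr p) powr (q / p))"
      using m[of Q] pq by (simp add: enn_powr_ennreal powr_mult powr_powr mult_ac flip: ennreal_mult')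
  qed
  also have "\<dots> \<le> ennreal (2 powr q) * (embedding_const \<Psi> p q \<Lambda>
      * enn_powr (\<integral>\<^sup>+ x. ennreal (F x powr p) \<partial>lebesgue) (q / p))"
    unfolding sum_distrib_left[symmetric]
  proof (intro mult_left_mono sum_below_lux_le \<Psi>(1) pq S' \<Lambda>(2) F)
    show "ennreal (m Q) < lux \<Psi> Q (\<lambda>x. ennreal (F x))" if "Q \<in> S'" for Q
      using m[OF that] by (simp add: L_def ennreal_lessI)
  qed (use S(3,4) \<open>S' \<subseteq> S\<close> m(1) in auto)
  finally show ?thesis
    by (simp add: L_def mult.assoc)
qed

subsection \<open>Generalised Hoelder inequality\<close>

definition power_mean :: "real \<Rightarrow> ('a::euclidean_space \<Rightarrow> real) \<Rightarrow> 'a set \<Rightarrow> ennreal" where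
  "power_mean r f Q = enn_powr (avg Q (\<lambda>x. ennreal (\<bar>f x\<bar> powr r))) (1 / r)"

definition young_pair :: "real \<Rightarrow> (real \<Rightarrow> real) \<Rightarrow> (real \<Rightarrow> real) \<Rightarrow> bool" where
  "young_pair r \<phi> \<Psi> \<longleftrightarrow> young \<phi> \<and> young \<Psi> \<and> (\<forall>t>0. young_inv \<Psi> t = t powr (1 / r) / young_inv \<phi> t)"

lemma Y_classE:
  assumes "\<phi> \<in> Y_class r B"
  obtains \<Psi> where "young_pair r \<phi> \<Psi>" "\<Psi> \<in> B"
  using assms by (auto simp: Y_class_def young_pair_def)

lemma young_pair_mult_powr_le:
  assumes pair: "young_pair r \<phi> \<Psi>" and "0 < r" "0 \<le> a" "0 \<le> b"
  shows "(a * b) powr r \<le> \<Psi> a + \<phi> b"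
proof (cases "a = 0 \<or> b = 0")
  case True
  then show ?thesis
    using assms by (auto simp: young_pair_def young_0 young_nonneg)
next
  case False
  have \<phi>: "young \<phi>" and \<Psi>: "young \<Psi>"
    using pair by (auto simp: young_pair_def)
  define t where "t = max (\<Psi> a) (\<phi> b)"
  have t_bounds: "0 < t" "t \<le> \<Psi> a + \<phi> b"
    using young_pos[OF \<Psi>, of a] young_pos[OF \<phi>, of b] False assms by (auto simp: t_def)
  have "a * b \<le> young_inv \<Psi> t * young_inv \<phi> t"
    using assms le_young_inv[OF \<Psi>, of a t] le_young_inv[OF \<phi>, of b t]
    by (intro mult_mono) (auto simp: t_def)
  also have "\<dots> = t powr (1 / r)"
    using pair t_bounds(1) young_inv_pos[OF \<phi> t_bounds(1)] by (auto simp: young_pair_def)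
  finally have "(a * b) powr r \<le> (t powr (1 / r)) powr r"
    using assms by (intro powr_mono2) auto
  then show ?thesis
    using t_bounds \<open>0 < r\<close> by (simp add: powr_powr)
qed

lemma powr_le_young_pair_sum:
  assumes pair: "young_pair r \<phi> \<Psi>" and r: "0 < r" and scales_pos: "0 < m" "0 < l" and F_nonneg: "0 \<le> F"
    and f: "W < \<infinity> \<Longrightarrow> \<bar>f\<bar> \<le> F * enn2real W"
  shows "ennreal (\<bar>f\<bar> powr r)
    \<le> ennreal ((m * l) powr r) * (young_ext \<Psi> (ennreal F / ennreal m) + young_ext \<phi> (W / ennreal l))"
proof (cases W)
  case (real w)
  have nonneg: "0 \<le> \<Psi> (F / m)" "0 \<le> \<phi> (w / l)"
    using pair real F_nonneg scales_pos by (auto simp: young_pair_def young_nonneg)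
  have "\<bar>f\<bar> powr r \<le> (m * l * (F / m * (w / l))) powr r"
    using f real scales_pos r by (intro powr_mono2) auto
  also have "\<dots> = (m * l) powr r * (F / m * (w / l)) powr r"
    by (rule powr_mult)
  also have "\<dots> \<le> (m * l) powr r * (\<Psi> (F / m) + \<phi> (w / l))"
    using real F_nonneg scales_pos by (intro mult_left_mono young_pair_mult_powr_le[OF pair r]) auto
  finally show ?thesis
    using nonneg real F_nonneg scales_pos
    by (simp add: young_ext_def divide_ennreal ennreal_leI flip: ennreal_mult' ennreal_plus)
next
  case top
  then show ?thesis
    using scales_pos by (simp add: young_ext_def ennreal_top_divide ennreal_mult_top)
qed

text \<open>Where \<open>W\<close> is infinite no bound on \<open>f\<close> is required: \<open>v\<^bsup>-1/p\<^esup>\<close> is infinite at the zeros of \<open>v\<close>.\<close>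

lemma power_mean_le_lux_mult:
  fixes f F :: "'a::euclidean_space \<Rightarrow> real" and W :: "'a \<Rightarrow> ennreal"
  assumes pair: "young_pair r \<phi> \<Psi>" and r: "0 < r" and Q: "Q \<in> sets lebesgue"
    and F: "F \<in> borel_measurable lebesgue" "\<And>x. 0 \<le> F x" and W: "W \<in> borel_measurable lebesgue"
    and f: "\<And>x. W x < \<infinity> \<Longrightarrow> \<bar>f x\<bar> \<le> F x * enn2real (W x)"
    and lux: "0 < lux \<phi> Q W" "lux \<phi> Q W < \<infinity>"
  shows "power_mean r f Q \<le> ennreal (2 powr (1 / r)) * lux \<phi> Q W * lux \<Psi> Q (\<lambda>x. ennreal (F x))"
proof (rule le_mult_lux)
  have young: "young \<phi>" "young \<Psi>"
    using pair by (auto simp: young_pair_def)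
  fix m :: real assume admissible_m: "0 < m" "avg Q (\<lambda>x. young_ext \<Psi> (ennreal (F x) / ennreal m)) \<le> 1"
  have "power_mean r f Q \<le> ennreal (2 powr (1 / r) * m) * lux \<phi> Q W"
  proof (rule le_mult_lux)
    fix l :: real assume admissible_l: "0 < l" "avg Q (\<lambda>x. young_ext \<phi> (W x / ennreal l)) \<le> 1"
    note [measurable] = F(1) W Q
    have [measurable]: "(\<lambda>x. young_ext \<Psi> (ennreal (F x) / ennreal m)) \<in> borel_measurable lebesgue"
        "(\<lambda>x. young_ext \<phi> (W x / ennreal l)) \<in> borel_measurable lebesgue"
      by (auto intro!: borel_measurable_young_ext young)
    have "avg Q (\<lambda>x. ennreal (\<bar>f x\<bar> powr r)) \<le> avg Q (\<lambda>x. ennreal ((m * l) powr r)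
        * (young_ext \<Psi> (ennreal (F x) / ennreal m) + young_ext \<phi> (W x / ennreal l)))"
      using F f by (intro avg_mono powr_le_young_pair_sum[OF pair r admissible_m(1) admissible_l(1)]) auto
    also have "\<dots> = ennreal ((m * l) powr r) * (avg Q (\<lambda>x. young_ext \<Psi> (ennreal (F x) / ennreal m))
        + avg Q (\<lambda>x. young_ext \<phi> (W x / ennreal l)))"
      by (simp add: avg_cmult avg_add)
    also have "\<dots> \<le> ennreal ((m * l) powr r) * (1 + 1)"
      using admissible_m(2) admissible_l(2) by (intro mult_left_mono add_mono) auto
    also have "\<dots> = ennreal ((m * l) powr r * 2)"
      by (simp add: ennreal_mult')
    finally have "power_mean r f Q \<le> enn_powr (ennreal ((m * l) powr r * 2)) (1 / r)"
      unfolding power_mean_def using r by (intro enn_powr_mono) auto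
    also have "\<dots> = ennreal (2 powr (1 / r) * m) * ennreal l"
      using admissible_m(1) admissible_l(1) r
      by (simp add: enn_powr_ennreal powr_mult powr_powr mult_ac flip: ennreal_mult')
    finally show "power_mean r f Q \<le> ennreal (2 powr (1 / r) * m) * ennreal l" .
  qed (use admissible_m(1) in auto)
  then show "power_mean r f Q \<le> ennreal (2 powr (1 / r)) * lux \<phi> Q W * ennreal m"
    using admissible_m(1) by (simp add: ennreal_mult' mult_ac)
qed (use lux in \<open>auto simp: ennreal_zero_less_mult_iff ennreal_mult_less_top\<close>)

subsection \<open>Weighted functions\<close>

definition weighted :: "real \<Rightarrow> ('a \<Rightarrow> real) \<Rightarrow> ('a \<Rightarrow> real) \<Rightarrow> 'a \<Rightarrow> real" where
  "weighted p v f x = \<bar>f x\<bar> * v x powr (1 / p)"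

lemma weighted_nonneg: "0 \<le> weighted p v f x"
  by (simp add: weighted_def)

lemma borel_measurable_weighted:
  assumes [measurable]: "v \<in> borel_measurable M" "f \<in> borel_measurable M"
  shows "weighted p v f \<in> borel_measurable M"
  unfolding weighted_def[abs_def] by measurable

lemma nn_integral_weighted_powr:
  assumes "0 < p" "\<And>x. 0 \<le> v x"
  shows "(\<integral>\<^sup>+ x. ennreal (weighted p v f x powr p) \<partial>lebesgue) = enn_powr (wnorm v p (\<lambda>x. ennreal \<bar>f x\<bar>)) p"
  using assms
  by (simp add: weighted_def wnorm_def enn_powr_powr enn_powr_ennreal powr_mult powr_powr ennreal_mult')

lemma borel_measurable_neg_root:
  assumes [measurable]: "v \<in> borel_measurable M"
  shows "neg_root v p \<in> borel_measurable M"
  unfolding neg_root_def[abs_def] by measurable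

lemma lux_neg_root_pos:
  fixes v :: "'a::euclidean_space \<Rightarrow> real"
  assumes "young \<phi>" "Q \<in> lmeasurable" "0 < vol Q" "v \<in> borel_measurable lebesgue" "\<And>x. 0 \<le> v x"
  shows "0 < lux \<phi> Q (neg_root v p)"
  using assms by (intro lux_pos borel_measurable_neg_root) (auto simp: neg_root_def)

lemma power_mean_le_weighted_lux:
  fixes f v :: "'a::euclidean_space \<Rightarrow> real"
  assumes pair: "young_pair r \<phi> \<Psi>" and r: "0 < r" and Q: "Q \<in> lmeasurable" "0 < vol Q"
    and v: "v \<in> borel_measurable lebesgue" "\<And>x. 0 \<le> v x" and f: "f \<in> borel_measurable lebesgue"
    and lux: "lux \<phi> Q (neg_root v p) < \<infinity>"
  shows "power_mean r f Q
    \<le> ennreal (2 powr (1 / r)) * lux \<phi> Q (neg_root v p) * lux \<Psi> Q (\<lambda>x. ennreal (weighted p v f x))"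
proof (rule power_mean_le_lux_mult[OF pair r])
  show "\<bar>f x\<bar> \<le> weighted p v f x * enn2real (neg_root v p x)" if "neg_root v p x < \<infinity>" for x
  proof -
    have "v x \<noteq> 0"
      using that by (auto simp: neg_root_def)
    then have "v x powr (1 / p) * v x powr (- 1 / p) = 1"
      using v(2)[of x] by (simp flip: powr_add)
    then show ?thesis
      using \<open>v x \<noteq> 0\<close> by (simp add: weighted_def neg_root_def mult.assoc)
  qed
  show "0 < lux \<phi> Q (neg_root v p)"
    using pair Q v by (intro lux_neg_root_pos) (auto simp: young_pair_def)
qed (use Q v f lux in \<open>auto intro: borel_measurable_weighted borel_measurable_neg_root weighted_nonneg\<close>)

definition lux_mass ::
    "(real \<Rightarrow> real) \<Rightarrow> real \<Rightarrow> ('a::euclidean_space \<Rightarrow> real) \<Rightarrow> ('a \<Rightarrow> real) \<Rightarrow> 'a set \<Rightarrow> ennreal" where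
  "lux_mass \<Psi> p v f Q = ennreal (vol Q) * enn_powr (lux \<Psi> Q (\<lambda>x. ennreal (weighted p v f x))) p"

lemma sum_lux_mass_le:
  fixes f v :: "'a::euclidean_space \<Rightarrow> real"
  assumes \<Psi>: "young \<Psi>" "\<Psi> \<in> B_class p q" and pq: "0 < p" "p \<le> q"
    and S: "finite S" "laminar S" "\<And>Q. Q \<in> S \<Longrightarrow> Q \<in> lmeasurable" "\<And>Q. Q \<in> S \<Longrightarrow> 0 < vol Q"
    and \<Lambda>: "carleson lebesgue \<Lambda> S" "0 \<le> \<Lambda>"
    and v: "v \<in> borel_measurable lebesgue" "\<And>x. 0 \<le> v x" and f: "f \<in> borel_measurable lebesgue"
    and norm_finite: "wnorm v p (\<lambda>x. ennreal \<bar>f x\<bar>) < \<infinity>"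
  shows "(\<Sum>Q\<in>S. enn_powr (lux_mass \<Psi> p v f Q) (q / p))
    \<le> ennreal (2 powr q) * embedding_const \<Psi> p q \<Lambda> * enn_powr (wnorm v p (\<lambda>x. ennreal \<bar>f x\<bar>)) q"
proof -
  note norm = nn_integral_weighted_powr[of p v f, OF pq(1) v(2)]
  have "(\<integral>\<^sup>+ x. ennreal (weighted p v f x powr p) \<partial>lebesgue) < \<infinity>"
    using norm_finite by (simp add: norm less_top[symmetric])
  from sum_lux_le[OF \<Psi> pq S \<Lambda> borel_measurable_weighted[OF v(1) f] weighted_nonneg this]
  show ?thesis
    using pq by (simp add: norm lux_mass_def enn_powr_powr)
qed

subsection \<open>Bilinear means\<close>

definition bilinear_mean ::
    "real \<Rightarrow> real \<Rightarrow> real \<Rightarrow> ('a::euclidean_space \<Rightarrow> real) \<Rightarrow> ('a \<Rightarrow> real) \<Rightarrow> 'a set \<Rightarrow> ennreal" where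
  "bilinear_mean \<alpha> r s f g Q
     = ennreal (vol Q powr (\<alpha> / real DIM('a))) * power_mean r f Q * power_mean s g Q"

lemma frac_max_eq_SUP_bilinear_mean:
  "frac_max \<alpha> r s f g x = (SUP Q\<in>{Q. is_cube Q \<and> x \<in> Q}. bilinear_mean \<alpha> r s f g Q)"
  by (simp add: frac_max_def bilinear_mean_def power_mean_def)

lemma power_mean_le_of_avg_le:
  assumes "1 \<le> \<kappa>" "1 \<le> r"
    and "avg Q (\<lambda>x. ennreal (\<bar>f x\<bar> powr r)) \<le> ennreal \<kappa> * avg R (\<lambda>x. ennreal (\<bar>f x\<bar> powr r))"
  shows "power_mean r f Q \<le> ennreal \<kappa> * power_mean r f R"
proof -
  have "power_mean r f Q \<le> enn_powr (ennreal \<kappa> * avg R (\<lambda>x. ennreal (\<bar>f x\<bar> powr r))) (1 / r)"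
    unfolding power_mean_def using assms by (intro enn_powr_mono) auto
  also have "\<dots> = ennreal (\<kappa> powr (1 / r)) * power_mean r f R"
    using assms by (simp add: enn_powr_mult enn_powr_ennreal power_mean_def)
  also have "\<dots> \<le> ennreal \<kappa> * power_mean r f R"
    using powr_mono[of "1 / r" 1 \<kappa>] assms by (intro mult_right_mono ennreal_leI) auto
  finally show ?thesis .
qed

lemma bilinear_mean_le_of_avg_le:
  fixes f g :: "'a::euclidean_space \<Rightarrow> real"
  assumes "1 \<le> \<kappa>" "1 \<le> r" "1 \<le> s" "0 \<le> \<alpha>" "vol Q \<le> vol R"
    and "avg Q (\<lambda>x. ennreal (\<bar>f x\<bar> powr r)) \<le> ennreal \<kappa> * avg R (\<lambda>x. ennreal (\<bar>f x\<bar> powr r))"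
    and "avg Q (\<lambda>x. ennreal (\<bar>g x\<bar> powr s)) \<le> ennreal \<kappa> * avg R (\<lambda>x. ennreal (\<bar>g x\<bar> powr s))"
  shows "bilinear_mean \<alpha> r s f g Q \<le> ennreal (\<kappa> * \<kappa>) * bilinear_mean \<alpha> r s f g R"
proof -
  have "bilinear_mean \<alpha> r s f g Q \<le> ennreal (vol R powr (\<alpha> / real DIM('a)))
      * (ennreal \<kappa> * power_mean r f R) * (ennreal \<kappa> * power_mean s g R)"
    unfolding bilinear_mean_def using assms
    by (intro mult_mono power_mean_le_of_avg_le ennreal_leI powr_mono2) auto
  also have "\<dots> = ennreal (\<kappa> * \<kappa>) * bilinear_mean \<alpha> r s f g R"
    using assms(1) by (simp add: bilinear_mean_def ennreal_mult' mult_ac)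
  finally show ?thesis .
qed

lemma bilinear_mean_le_enlarged:
  fixes f g :: "'a::euclidean_space \<Rightarrow> real"
  assumes QR: "Q \<subseteq> R" "Q \<in> sets lebesgue" "R \<in> lmeasurable" "0 < vol Q" "vol R \<le> \<kappa> * vol Q"
    and \<kappa>: "1 \<le> \<kappa>" and "1 \<le> r" "1 \<le> s" "0 \<le> \<alpha>"
  shows "bilinear_mean \<alpha> r s f g Q \<le> ennreal (\<kappa> * \<kappa>) * bilinear_mean \<alpha> r s f g R"
proof -
  have vol_le: "vol Q \<le> vol R"
    using QR by (intro measure_mono_fmeasurable)
  have avg_le: "avg Q F \<le> ennreal \<kappa> * avg R F" for F
  proof -
    have "1 / vol Q \<le> \<kappa> * (1 / vol R)"
      using QR vol_le by (simp add: field_simps)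
    then have "ennreal (1 / vol Q) \<le> ennreal \<kappa> * ennreal (1 / vol R)"
      using \<kappa> by (simp add: ennreal_leI flip: ennreal_mult')
    moreover have "(\<integral>\<^sup>+ x\<in>Q. F x \<partial>lebesgue) \<le> (\<integral>\<^sup>+ x\<in>R. F x \<partial>lebesgue)"
      using QR by (intro nn_set_integral_set_mono) auto
    ultimately show ?thesis
      unfolding avg_def mult.assoc[symmetric] by (rule mult_mono) auto
  qed
  show ?thesis
    using assms vol_le avg_le by (intro bilinear_mean_le_of_avg_le) auto
qed

subsection \<open>Principal subfamilies of bilinear means are sparse\<close>

lemma mult_vol_Union_le_nn_integral:
  fixes S :: "'a::euclidean_space set set"
  assumes S: "finite S" "laminar S" "\<And>Q. Q \<in> S \<Longrightarrow> Q \<in> lmeasurable" "\<And>Q. Q \<in> S \<Longrightarrow> 0 < vol Q"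
    and h [measurable]: "h \<in> borel_measurable lebesgue" and R [measurable]: "R \<in> sets lebesgue"
    and members_subset: "\<And>Q. Q \<in> S \<Longrightarrow> Q \<subseteq> R" and avg_ge: "\<And>Q. Q \<in> S \<Longrightarrow> c \<le> avg Q h"
  shows "c * ennreal (vol (\<Union>S)) \<le> (\<integral>\<^sup>+ x\<in>R. h x \<partial>lebesgue)"
proof -
  have Union_lmeasurable: "\<Union>S \<in> lmeasurable"
    using S by (intro fmeasurable.finite_Union) auto
  have "c * emeasure lebesgue (\<Union>S) \<le> emeasure (density lebesgue h) (\<Union>S)"
  proof (rule emeasure_Union_laminar_le)
    fix Q assume Q: "Q \<in> S"
    then have "emeasure (density lebesgue h) Q = ennreal (vol Q) * avg Q h"
      using S by (simp add: emeasure_density nn_set_integral_eq_avg fmeasurableD)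
    then show "c * emeasure lebesgue Q \<le> emeasure (density lebesgue h) Q"
      using avg_ge[OF Q] S(3)[OF Q]
      by (simp add: emeasure_eq_measure2 mult.commute[of "ennreal (vol Q)"] mult_right_mono)
  qed (use S in auto)
  also have "\<dots> \<le> emeasure (density lebesgue h) R"
    using members_subset by (intro emeasure_mono) auto
  finally show ?thesis
    using Union_lmeasurable by (simp add: emeasure_eq_measure2 emeasure_density)
qed

lemma vol_Union_avg_jump_le:
  fixes S :: "'a::euclidean_space set set"
  assumes S: "finite S" "laminar S" "\<And>Q. Q \<in> S \<Longrightarrow> Q \<in> lmeasurable" "\<And>Q. Q \<in> S \<Longrightarrow> 0 < vol Q"
    and h: "h \<in> borel_measurable lebesgue"
    and R: "R \<in> lmeasurable" "0 < vol R" and A_pos: "0 < A"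
  shows "vol (\<Union>{Q\<in>S. Q \<subset> R \<and> ennreal A * avg R h < avg Q h}) \<le> vol R / A"
proof -
  define T where "T = {Q\<in>S. Q \<subset> R \<and> ennreal A * avg R h < avg Q h}"
  have T: "finite T" "laminar T" "\<And>Q. Q \<in> T \<Longrightarrow> Q \<in> lmeasurable \<and> 0 < vol Q \<and> Q \<subset> R"
    using S laminar_subset[OF S(2), of T] by (auto simp: T_def)
  have weak_type: "c * ennreal (vol (\<Union>T')) \<le> ennreal (vol R) * avg R h"
    if "T' \<subseteq> T" "\<And>Q. Q \<in> T' \<Longrightarrow> c \<le> avg Q h" for T' c
    using mult_vol_Union_le_nn_integral[of T' h R c] that T h R(1) laminar_subset[OF T(2) that(1)]
      finite_subset[OF that(1) T(1)] by (auto simp: nn_set_integral_eq_avg[OF R(2)])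
  consider (zero) "avg R h = 0" | (top) "avg R h = top" | (finite) a where "avg R h = ennreal a" "0 < a"
    by (cases "avg R h") (auto simp: less_le)
  then have "vol (\<Union>T) \<le> vol R / A"
  proof cases
    case zero
    have False if "Q \<in> T" for Q
      using weak_type[of "{Q}" "avg Q h"] that T(3)[OF that] zero by (auto simp: T_def)
    then have "T = {}"
      by blast
    then show ?thesis
      using R A_pos by simp
  next
    case top
    then have "T = {}"
      using A_pos by (auto simp: T_def ennreal_mult_top)
    then show ?thesis
      using R A_pos by simp
  next
    case finite
    have "ennreal A * avg R h * ennreal (vol (\<Union>T)) \<le> ennreal (vol R) * avg R h"
      by (rule weak_type) (auto simp: T_def)
    then have "A * a * vol (\<Union>T) \<le> vol R * a"
      using finite A_pos by (simp flip: ennreal_mult')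
    then show ?thesis
      using finite A_pos by (simp add: field_simps)
  qed
  then show ?thesis
    by (simp add: T_def)
qed

lemma sparse_of_avg_jumps:
  fixes S :: "'a::euclidean_space set set"
  assumes S: "finite S" "laminar S" "\<And>Q. Q \<in> S \<Longrightarrow> Q \<in> lmeasurable" "\<And>Q. Q \<in> S \<Longrightarrow> 0 < vol Q"
    and measurable_hk: "h \<in> borel_measurable lebesgue" "k \<in> borel_measurable lebesgue"
    and jump: "\<And>Q R. Q \<in> S \<Longrightarrow> R \<in> S \<Longrightarrow> Q \<subset> R \<Longrightarrow>
      4 * avg R h < avg Q h \<or> 4 * avg R k < avg Q k"
  shows "sparse lebesgue (1 / 2) S"
  unfolding sparse_def
proof
  fix R assume R: "R \<in> S"
  define J where "J h = \<Union>{Q\<in>S. Q \<subset> R \<and> 4 * avg R h < avg Q h}" for h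
  have J_lmeasurable: "J h \<in> lmeasurable" for h
    unfolding J_def using S by (intro fmeasurable.finite_Union) auto
  have "\<Union>{Q\<in>S. Q \<subset> R} \<in> lmeasurable"
    using S by (intro fmeasurable.finite_Union) auto
  then have "vol (R - \<Union>{Q\<in>S. Q \<subset> R}) = vol R - vol (\<Union>{Q\<in>S. Q \<subset> R})"
    using R S by (intro measurable_measure_Diff) auto
  moreover have "vol (\<Union>{Q\<in>S. Q \<subset> R}) \<le> vol (J h \<union> J k)"
  proof (rule measure_mono_fmeasurable)
    show "\<Union>{Q\<in>S. Q \<subset> R} \<subseteq> J h \<union> J k"
      unfolding J_def using jump R by blast
  qed (use J_lmeasurable \<open>\<Union>{Q\<in>S. Q \<subset> R} \<in> lmeasurable\<close> in auto)
  moreover have "vol (J h \<union> J k) \<le> vol (J h) + vol (J k)"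
    using J_lmeasurable by (intro measure_Un_le) auto
  moreover have "vol (J h) \<le> vol R / 4" "vol (J k) \<le> vol R / 4"
    using vol_Union_avg_jump_le[OF S measurable_hk(1), of R 4]
      vol_Union_avg_jump_le[OF S measurable_hk(2), of R 4] S R
    by (simp_all add: J_def)
  ultimately show "1 / 2 * vol R \<le> vol (R - \<Union>{Q\<in>S. Q \<subset> R})"
    by simp
qed

text \<open>If both averages grow by a factor of at most \<open>4\<close>, the product of the means grows by at most \<open>16\<close>.\<close>

lemma principal_bilinear_mean_carleson:
  fixes S :: "'a::euclidean_space set set"
  assumes S: "finite S" "laminar S" "\<And>Q. Q \<in> S \<Longrightarrow> Q \<in> lmeasurable" "\<And>Q. Q \<in> S \<Longrightarrow> 0 < vol Q"
    and P: "principal_subfamily (bilinear_mean \<alpha> r s f g) (\<lambda>Q. 16 * bilinear_mean \<alpha> r s f g Q) S P"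
    and exponents: "1 \<le> r" "1 \<le> s" "0 \<le> \<alpha>"
    and [measurable]: "f \<in> borel_measurable lebesgue" "g \<in> borel_measurable lebesgue"
  shows "carleson lebesgue 2 P"
proof -
  have "P \<subseteq> S"
    using P by (simp add: principal_subfamily_def)
  then have P_family: "finite P" "laminar P" "\<And>Q. Q \<in> P \<Longrightarrow> Q \<in> lmeasurable" "\<And>Q. Q \<in> P \<Longrightarrow> 0 < vol Q"
    using S by (auto intro: finite_subset laminar_subset)
  have "sparse lebesgue (1 / 2) P"
  proof (rule sparse_of_avg_jumps[OF P_family])
    fix Q R assume QR: "Q \<in> P" "R \<in> P" "Q \<subset> R"
    then have "16 * bilinear_mean \<alpha> r s f g R < bilinear_mean \<alpha> r s f g Q"
      using P by (simp add: principal_subfamily_def)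
    moreover have "vol Q \<le> vol R"
      using QR P_family by (intro measure_mono_fmeasurable) auto
    ultimately show "4 * avg R (\<lambda>x. ennreal (\<bar>f x\<bar> powr r)) < avg Q (\<lambda>x. ennreal (\<bar>f x\<bar> powr r)) \<or>
        4 * avg R (\<lambda>x. ennreal (\<bar>g x\<bar> powr s)) < avg Q (\<lambda>x. ennreal (\<bar>g x\<bar> powr s))"
      using bilinear_mean_le_of_avg_le[of 4 r s \<alpha> Q R f g] exponents by (force simp: not_less)
  qed measurable
  then show ?thesis
    using sparse_imp_carleson[of P lebesgue "1 / 2"] P_family by auto
qed

definition family_max :: "('a set \<Rightarrow> ennreal) \<Rightarrow> real \<Rightarrow> 'a set set \<Rightarrow> 'a \<Rightarrow> ennreal" where
  "family_max a q S x = (SUP Q\<in>S. enn_powr (a Q) q * indicator Q x)"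

lemma borel_measurable_family_max:
  assumes "finite S" "S \<subseteq> sets M"
  shows "family_max a q S \<in> borel_measurable M"
  unfolding family_max_def[abs_def] using assms
  by (intro borel_measurable_SUP countable_finite) auto

lemma nn_integral_family_max_le_principal_sum:
  fixes a :: "'a set \<Rightarrow> ennreal"
  assumes "finite S" "S \<subseteq> sets M" and P: "principal_subfamily a (\<lambda>Q. A * a Q) S P"
    and [measurable]: "u \<in> borel_measurable M" and "0 \<le> q"
  shows "(\<integral>\<^sup>+ x. family_max a q S x * u x \<partial>M)
    \<le> enn_powr A q * (\<Sum>R\<in>P. enn_powr (a R) q * (\<integral>\<^sup>+ x\<in>R. u x \<partial>M))"
proof -
  have "P \<subseteq> S"
    using P by (simp add: principal_subfamily_def)
  then have finite_P: "finite P" and [measurable]: "\<And>R. R \<in> P \<Longrightarrow> R \<in> sets M"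
    using assms by (auto intro: finite_subset)
  have "family_max a q S x \<le> (\<Sum>R\<in>P. enn_powr A q * enn_powr (a R) q * indicator R x)" for x
    unfolding family_max_def
  proof (rule SUP_least)
    fix Q assume "Q \<in> S"
    then obtain R where R: "R \<in> P" "Q \<subseteq> R" "a Q \<le> A * a R"
      using P by (auto simp: principal_subfamily_def)
    then have "enn_powr (a Q) q * indicator Q x \<le> enn_powr A q * enn_powr (a R) q * indicator R x"
      unfolding enn_powr_mult[symmetric] using \<open>0 \<le> q\<close>
      by (intro mult_mono enn_powr_mono) (auto simp: indicator_def)
    also have "\<dots> \<le> (\<Sum>R\<in>P. enn_powr A q * enn_powr (a R) q * indicator R x)"
      using R(1) finite_P by (intro member_le_sum) auto
    finally show "enn_powr (a Q) q * indicator Q x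
        \<le> (\<Sum>R\<in>P. enn_powr A q * enn_powr (a R) q * indicator R x)" .
  qed
  then have "(\<integral>\<^sup>+ x. family_max a q S x * u x \<partial>M)
      \<le> (\<integral>\<^sup>+ x. (\<Sum>R\<in>P. enn_powr A q * enn_powr (a R) q * indicator R x) * u x \<partial>M)"
    by (intro nn_integral_mono mult_right_mono) auto
  also have "\<dots> = (\<integral>\<^sup>+ x. (\<Sum>R\<in>P. enn_powr A q * enn_powr (a R) q * (u x * indicator R x)) \<partial>M)"
    by (simp add: sum_distrib_left mult_ac)
  also have "\<dots> = enn_powr A q * (\<Sum>R\<in>P. enn_powr (a R) q * (\<integral>\<^sup>+ x\<in>R. u x \<partial>M))"
    by (simp add: nn_integral_sum nn_integral_cmult sum_distrib_left mult.assoc)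
  finally show ?thesis .
qed

subsection \<open>Cubes up to null sets\<close>

lemma vol_cube:
  fixes a :: "'a::euclidean_space"
  assumes "0 < h"
  shows "vol (cbox a (a + h *\<^sub>R One)) = h ^ DIM('a)"
proof -
  have "vol (cbox a (a + h *\<^sub>R One)) = (\<Prod>i\<in>Basis. (a + h *\<^sub>R One) \<bullet> i - a \<bullet> i)"
    using assms by (simp add: measure_completion content_cbox inner_add_left)
  also have "\<dots> = (\<Prod>i\<in>(Basis::'a set). h)"
    by (intro prod.cong) (auto simp: inner_add_left)
  finally show ?thesis
    by simp
qed

lemma is_cube_lmeasurable: "is_cube Q \<Longrightarrow> Q \<in> lmeasurable"
  by (auto simp: is_cube_def)

lemma is_cube_vol_pos:
  assumes "is_cube Q"
  shows "0 < vol Q"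
proof -
  obtain a h where "0 < h" "Q = cbox a (a + h *\<^sub>R One)"
    using assms by (auto simp: is_cube_def)
  then show ?thesis
    by (simp only: vol_cube zero_less_power)
qed

text \<open>Half-open cubes, unlike closed ones, tile exactly.\<close>

definition almost_cube :: "'a::euclidean_space set \<Rightarrow> bool" where
  "almost_cube Q \<longleftrightarrow> (\<exists>Q'. is_cube Q' \<and> Q \<subseteq> Q' \<and> Q' - Q \<in> null_sets lebesgue)"

lemma almost_cube_imp_lmeasurable:
  assumes "almost_cube Q"
  shows "Q \<in> lmeasurable"
proof -
  obtain Q' where Q': "is_cube Q'" "Q \<subseteq> Q'" "Q' - Q \<in> null_sets lebesgue"
    using assms by (auto simp: almost_cube_def)
  then have "Q' - (Q' - Q) \<in> lmeasurable"
    by (intro fmeasurable_Diff is_cube_lmeasurable null_setsD2)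
  also have "Q' - (Q' - Q) = Q"
    using Q'(2) by blast
  finally show ?thesis .
qed

lemma almost_cubeE:
  assumes "almost_cube Q"
  obtains Q' where "is_cube Q'" "vol Q = vol Q'" "avg Q = avg Q'"
proof -
  obtain Q' where Q': "is_cube Q'" "Q \<subseteq> Q'" "Q' - Q \<in> null_sets lebesgue"
    using assms by (auto simp: almost_cube_def)
  note sets = fmeasurableD[OF almost_cube_imp_lmeasurable[OF assms]]
    fmeasurableD[OF is_cube_lmeasurable[OF Q'(1)]]
  have "Q' = Q \<union> (Q' - Q)"
    using Q'(2) by blast
  then have vol: "vol Q = vol Q'"
    using Q'(3) sets by (metis measure_Un_null_set)
  have "(\<integral>\<^sup>+ x\<in>Q. F x \<partial>lebesgue) = (\<integral>\<^sup>+ x\<in>Q'. F x \<partial>lebesgue)" for F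
    using Q' sets by (intro nn_integral_null_delta) (simp_all add: Diff_eq_empty_iff[THEN iffD2])
  then show thesis
    using that[OF Q'(1) vol] by (simp add: avg_def vol fun_eq_iff)
qed

lemma almost_cube_vol_pos: "almost_cube Q \<Longrightarrow> 0 < vol Q"
  by (erule almost_cubeE) (simp add: is_cube_vol_pos)

subsection \<open>Two-weight bounds for finite laminar families\<close>

locale bump_weights =
  fixes \<alpha> r s p1 p2 p q :: real
    and u v1 v2 :: "'a::euclidean_space \<Rightarrow> real"
    and \<phi>1 \<phi>2 \<Psi>1 \<Psi>2 :: "real \<Rightarrow> real"
  assumes \<alpha>: "0 \<le> \<alpha>" and r: "1 < r" and s: "1 < s" and p1: "0 < p1" and p2: "0 < p2"
    and p: "p = p1 * p2 / (p1 + p2)" and pq: "p \<le> q"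
    and pair1: "young_pair r \<phi>1 \<Psi>1" and pair2: "young_pair s \<phi>2 \<Psi>2"
    and B1: "\<Psi>1 \<in> B_class p1 (p1 * q / p)" and B2: "\<Psi>2 \<in> B_class p2 (p2 * q / p)"
    and A_class: "(u, v1, v2) \<in> A_class \<alpha> p1 p2 q \<phi>1 \<phi>2"
begin

abbreviation norm1 :: "('a \<Rightarrow> real) \<Rightarrow> ennreal" where
  "norm1 f \<equiv> wnorm v1 p1 (\<lambda>x. ennreal \<bar>f x\<bar>)"

abbreviation norm2 :: "('a \<Rightarrow> real) \<Rightarrow> ennreal" where
  "norm2 g \<equiv> wnorm v2 p2 (\<lambda>x. ennreal \<bar>g x\<bar>)"

lemma p_pos: "0 < p"
  using p1 p2 by (simp add: p)

lemma q_pos: "0 < q"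
  using p_pos pq by simp

lemma conjugate_exponents: "p / p1 + p / p2 = 1"
  using p1 p2 by (simp add: p divide_simps)

lemma inverse_p: "1 / p = 1 / p1 + 1 / p2"
  using p1 p2 by (simp add: p divide_simps)

lemma weights:
  shows "u \<in> borel_measurable lebesgue" "v1 \<in> borel_measurable lebesgue" "v2 \<in> borel_measurable lebesgue"
    and "\<And>x. 0 \<le> v1 x" "\<And>x. 0 \<le> v2 x"
  using A_class by (auto simp: A_class_def weight_def)

definition bump_product :: "'a set \<Rightarrow> ennreal" where
  "bump_product Q = ennreal (vol Q powr (\<alpha> / real DIM('a) + 1 / q - 1 / p))
     * enn_powr (avg Q (\<lambda>x. ennreal (u x))) (1 / q) * lux \<phi>1 Q (neg_root v1 p1) * lux \<phi>2 Q (neg_root v2 p2)"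

definition bump_const :: ennreal where
  "bump_const = (SUP Q\<in>{Q. is_cube Q}. bump_product Q)"

lemma bump_const_finite: "bump_const < \<infinity>"
  using A_class unfolding A_class_def bump_const_def bump_product_def p[symmetric] by simp

lemma bump_product_le:
  assumes "almost_cube Q"
  shows "bump_product Q \<le> bump_const"
proof -
  obtain Q' where Q': "is_cube Q'" "vol Q = vol Q'" "avg Q = avg Q'"
    by (rule almost_cubeE[OF assms])
  then have "bump_product Q = bump_product Q'"
    by (simp add: bump_product_def lux_def)
  then show ?thesis
    using Q'(1) by (auto simp: bump_const_def intro: SUP_upper)
qed

lemma lux_neg_root_finite:
  assumes Q: "almost_cube Q" and u: "avg Q (\<lambda>x. ennreal (u x)) \<noteq> 0"
  shows "lux \<phi>1 Q (neg_root v1 p1) < \<infinity>" "lux \<phi>2 Q (neg_root v2 p2) < \<infinity>"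
proof -
  have "bump_product Q \<noteq> top"
    using bump_product_le[OF Q] bump_const_finite by (auto simp: top_unique)
  moreover have "0 < lux \<phi>1 Q (neg_root v1 p1)" "0 < lux \<phi>2 Q (neg_root v2 p2)"
    using pair1 pair2 weights Q almost_cube_imp_lmeasurable almost_cube_vol_pos
    by (auto simp: young_pair_def intro!: lux_neg_root_pos)
  moreover have "vol Q powr (\<alpha> / real DIM('a) + 1 / q - 1 / p) \<noteq> 0"
    using almost_cube_vol_pos[OF Q] by simp
  ultimately show "lux \<phi>1 Q (neg_root v1 p1) < \<infinity>" "lux \<phi>2 Q (neg_root v2 p2) < \<infinity>"
    using u by (auto simp: bump_product_def ennreal_mult_eq_top_iff less_top[symmetric])
qed

definition local_const :: ennreal where
  "local_const = ennreal (2 powr (1 / r)) * ennreal (2 powr (1 / s)) * bump_const"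

lemma bilinear_mean_weight_le:
  assumes Q: "almost_cube Q" and f: "f \<in> borel_measurable lebesgue" and g: "g \<in> borel_measurable lebesgue"
  shows "bilinear_mean \<alpha> r s f g Q * enn_powr (\<integral>\<^sup>+ x\<in>Q. ennreal (u x) \<partial>lebesgue) (1 / q)
    \<le> local_const * (ennreal (vol Q powr (1 / p)) * lux \<Psi>1 Q (\<lambda>x. ennreal (weighted p1 v1 f x))
        * lux \<Psi>2 Q (\<lambda>x. ennreal (weighted p2 v2 g x)))"
proof (cases "avg Q (\<lambda>x. ennreal (u x)) = 0")
  case True
  then show ?thesis
    by (simp add: nn_set_integral_eq_avg almost_cube_vol_pos[OF Q])
next
  case False
  define n where "n = real DIM('a)"
  define U where "U = enn_powr (avg Q (\<lambda>x. ennreal (u x))) (1 / q)"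
  define l1 l2 where "l1 = lux \<phi>1 Q (neg_root v1 p1)" and "l2 = lux \<phi>2 Q (neg_root v2 p2)"
  define L1 where "L1 = lux \<Psi>1 Q (\<lambda>x. ennreal (weighted p1 v1 f x))"
  define L2 where "L2 = lux \<Psi>2 Q (\<lambda>x. ennreal (weighted p2 v2 g x))"
  define k1 k2 where "k1 = ennreal (2 powr (1 / r))" and "k2 = ennreal (2 powr (1 / s))"
  have vol: "0 < vol Q"
    using Q by (rule almost_cube_vol_pos)
  have means: "power_mean r f Q \<le> k1 * l1 * L1" "power_mean s g Q \<le> k2 * l2 * L2"
    unfolding k1_def k2_def l1_def l2_def L1_def L2_def
    using r s weights f g lux_neg_root_finite[OF Q False] vol almost_cube_imp_lmeasurable[OF Q]
    by (auto intro!: power_mean_le_weighted_lux pair1 pair2)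
  have "enn_powr (\<integral>\<^sup>+ x\<in>Q. ennreal (u x) \<partial>lebesgue) (1 / q) = ennreal (vol Q powr (1 / q)) * U"
    using vol by (simp add: nn_set_integral_eq_avg enn_powr_mult enn_powr_ennreal U_def)
  then have "bilinear_mean \<alpha> r s f g Q * enn_powr (\<integral>\<^sup>+ x\<in>Q. ennreal (u x) \<partial>lebesgue) (1 / q)
      \<le> ennreal (vol Q powr (\<alpha> / n)) * (k1 * l1 * L1) * (k2 * l2 * L2) * (ennreal (vol Q powr (1 / q)) * U)"
    unfolding bilinear_mean_def n_def using means by (simp add: mult_mono mult_right_mono)
  also have "\<dots> = k1 * k2
      * (ennreal (vol Q powr (\<alpha> / n)) * ennreal (vol Q powr (1 / q)) * U * l1 * l2) * L1 * L2"
    by (simp only: mult_ac)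
  also have "ennreal (vol Q powr (\<alpha> / n)) * ennreal (vol Q powr (1 / q))
      = ennreal (vol Q powr (1 / p)) * ennreal (vol Q powr (\<alpha> / n + 1 / q - 1 / p))"
    by (simp flip: ennreal_mult' powr_add)
  also have "k1 * k2
        * (ennreal (vol Q powr (1 / p)) * ennreal (vol Q powr (\<alpha> / n + 1 / q - 1 / p)) * U * l1 * l2) * L1 * L2
      = k1 * k2 * bump_product Q * (ennreal (vol Q powr (1 / p)) * L1 * L2)"
    by (simp add: bump_product_def n_def U_def l1_def l2_def mult_ac)
  also have "\<dots> \<le> k1 * k2 * bump_const * (ennreal (vol Q powr (1 / p)) * L1 * L2)"
    using bump_product_le[OF Q] by (intro mult_right_mono mult_left_mono) auto
  finally show ?thesis
    by (simp add: local_const_def k1_def k2_def L1_def L2_def)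
qed

lemma bilinear_mean_powr_weight_le:
  assumes Q: "almost_cube Q" and f: "f \<in> borel_measurable lebesgue" and g: "g \<in> borel_measurable lebesgue"
  shows "enn_powr (bilinear_mean \<alpha> r s f g Q) q * (\<integral>\<^sup>+ x\<in>Q. ennreal (u x) \<partial>lebesgue)
    \<le> enn_powr local_const q
      * (enn_powr (lux_mass \<Psi>1 p1 v1 f Q) (q / p1) * enn_powr (lux_mass \<Psi>2 p2 v2 g Q) (q / p2))"
proof -
  define L1 where "L1 = lux \<Psi>1 Q (\<lambda>x. ennreal (weighted p1 v1 f x))"
  define L2 where "L2 = lux \<Psi>2 Q (\<lambda>x. ennreal (weighted p2 v2 g x))"
  have "enn_powr (bilinear_mean \<alpha> r s f g Q) q * (\<integral>\<^sup>+ x\<in>Q. ennreal (u x) \<partial>lebesgue)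
      = enn_powr (bilinear_mean \<alpha> r s f g Q * enn_powr (\<integral>\<^sup>+ x\<in>Q. ennreal (u x) \<partial>lebesgue) (1 / q)) q"
    using q_pos by (simp add: enn_powr_mult enn_powr_powr)
  also have "\<dots> \<le> enn_powr (local_const * (ennreal (vol Q powr (1 / p)) * L1 * L2)) q"
    unfolding L1_def L2_def using bilinear_mean_weight_le[OF assms] q_pos by (intro enn_powr_mono) auto
  also have "ennreal (vol Q powr (1 / p)) * L1 * L2
      = enn_powr (lux_mass \<Psi>1 p1 v1 f Q) (1 / p1) * enn_powr (lux_mass \<Psi>2 p2 v2 g Q) (1 / p2)"
    using p1 p2
    by (simp add: L1_def L2_def lux_mass_def inverse_p powr_add ennreal_mult' enn_powr_mult enn_powr_powr
        enn_powr_ennreal mult_ac)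
  finally show ?thesis
    by (simp add: enn_powr_mult enn_powr_powr)
qed

definition carleson_const :: ennreal where
  "carleson_const = enn_powr local_const q
     * (enn_powr (ennreal (2 powr (p1 * q / p)) * embedding_const \<Psi>1 p1 (p1 * q / p) 2) (p / p1)
      * enn_powr (ennreal (2 powr (p2 * q / p)) * embedding_const \<Psi>2 p2 (p2 * q / p) 2) (p / p2))"

lemma carleson_const_finite: "carleson_const < \<infinity>"
proof -
  have "embedding_const \<Psi>1 p1 (p1 * q / p) 2 < \<infinity>" "embedding_const \<Psi>2 p2 (p2 * q / p) 2 < \<infinity>"
    using embedding_const_finite[OF _ B1 p1] embedding_const_finite[OF _ B2 p2]
      pair1 pair2 p1 p2 p_pos q_pos
    by (auto simp: young_pair_def)
  with bump_const_finite show ?thesis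
    by (auto simp: carleson_const_def local_const_def ennreal_mult_eq_top_iff less_top[symmetric])
qed

lemma sum_bilinear_mean_le:
  assumes P: "finite P" "laminar P" "\<And>Q. Q \<in> P \<Longrightarrow> almost_cube Q" "carleson lebesgue 2 P"
    and f: "f \<in> borel_measurable lebesgue" "norm1 f < \<infinity>"
    and g: "g \<in> borel_measurable lebesgue" "norm2 g < \<infinity>"
  shows "(\<Sum>Q\<in>P. enn_powr (bilinear_mean \<alpha> r s f g Q) q * (\<integral>\<^sup>+ x\<in>Q. ennreal (u x) \<partial>lebesgue))
    \<le> carleson_const * enn_powr (norm1 f * norm2 g) q"
proof -
  define E1 where "E1 = ennreal (2 powr (p1 * q / p)) * embedding_const \<Psi>1 p1 (p1 * q / p) 2"
  define E2 where "E2 = ennreal (2 powr (p2 * q / p)) * embedding_const \<Psi>2 p2 (p2 * q / p) 2"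
  have young: "young \<Psi>1" "young \<Psi>2"
    using pair1 pair2 by (auto simp: young_pair_def)
  have exponents: "p1 \<le> p1 * q / p" "p2 \<le> p2 * q / p" "p1 * q / p / p1 = q / p" "p2 * q / p / p2 = q / p"
    using p1 p2 pq p_pos by (auto simp: field_simps)
  have mass_sum1: "(\<Sum>Q\<in>P. enn_powr (lux_mass \<Psi>1 p1 v1 f Q) (q / p)) \<le> E1 * enn_powr (norm1 f) (p1 * q / p)"
    using sum_lux_mass_le[OF young(1) B1 p1 exponents(1) P(1,2) almost_cube_imp_lmeasurable[OF P(3)]
        almost_cube_vol_pos[OF P(3)] P(4) _ weights(2,4) f] p1
    by (simp add: E1_def exponents)
  have mass_sum2: "(\<Sum>Q\<in>P. enn_powr (lux_mass \<Psi>2 p2 v2 g Q) (q / p)) \<le> E2 * enn_powr (norm2 g) (p2 * q / p)"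
    using sum_lux_mass_le[OF young(2) B2 p2 exponents(2) P(1,2) almost_cube_imp_lmeasurable[OF P(3)]
        almost_cube_vol_pos[OF P(3)] P(4) _ weights(3,5) g] p2
    by (simp add: E2_def exponents)
  have "(\<Sum>Q\<in>P. enn_powr (bilinear_mean \<alpha> r s f g Q) q * (\<integral>\<^sup>+ x\<in>Q. ennreal (u x) \<partial>lebesgue))
      \<le> (\<Sum>Q\<in>P. enn_powr local_const q * (enn_powr (enn_powr (lux_mass \<Psi>1 p1 v1 f Q) (q / p)) (p / p1)
          * enn_powr (enn_powr (lux_mass \<Psi>2 p2 v2 g Q) (q / p)) (p / p2)))"
    using bilinear_mean_powr_weight_le[OF P(3) f(1) g(1)] p_pos
    by (intro sum_mono) (simp add: enn_powr_powr)
  also have "\<dots> \<le> enn_powr local_const q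
      * (enn_powr (\<Sum>Q\<in>P. enn_powr (lux_mass \<Psi>1 p1 v1 f Q) (q / p)) (p / p1)
      * enn_powr (\<Sum>Q\<in>P. enn_powr (lux_mass \<Psi>2 p2 v2 g Q) (q / p)) (p / p2))"
    unfolding sum_distrib_left[symmetric] using P(1) p1 p2 p_pos conjugate_exponents
    by (intro mult_left_mono sum_Holder) auto
  also have "\<dots> \<le> enn_powr local_const q * (enn_powr (E1 * enn_powr (norm1 f) (p1 * q / p)) (p / p1)
      * enn_powr (E2 * enn_powr (norm2 g) (p2 * q / p)) (p / p2))"
    using mass_sum1 mass_sum2 p1 p2 p_pos by (intro mult_left_mono mult_mono enn_powr_mono) auto
  also have "\<dots> = carleson_const * enn_powr (norm1 f * norm2 g) q"
    using p1 p2 p_pos by (simp add: carleson_const_def E1_def E2_def enn_powr_mult enn_powr_powr mult_ac)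
  finally show ?thesis .
qed

lemma nn_integral_family_max_le:
  assumes S: "finite S" "laminar S" "\<And>Q. Q \<in> S \<Longrightarrow> almost_cube Q"
    and f: "f \<in> borel_measurable lebesgue" "norm1 f < \<infinity>"
    and g: "g \<in> borel_measurable lebesgue" "norm2 g < \<infinity>"
  shows "(\<integral>\<^sup>+ x. family_max (bilinear_mean \<alpha> r s f g) q S x * ennreal (u x) \<partial>lebesgue)
    \<le> enn_powr 16 q * carleson_const * enn_powr (norm1 f * norm2 g) q"
proof -
  let ?a = "bilinear_mean \<alpha> r s f g"
  have "?a Q \<le> 16 * ?a Q" for Q
    using mult_right_mono[of 1 16 "?a Q"] by simp
  then obtain P where P: "principal_subfamily ?a (\<lambda>Q. 16 * ?a Q) S P"
    using principal_subfamily_exists[OF S(1), of ?a "\<lambda>Q. 16 * ?a Q"] by blast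
  then have P_subset: "P \<subseteq> S"
    by (simp add: principal_subfamily_def)
  have carleson: "carleson lebesgue 2 P"
    using principal_bilinear_mean_carleson[OF S(1,2) almost_cube_imp_lmeasurable[OF S(3)]
        almost_cube_vol_pos[OF S(3)] P] r s \<alpha> f g by simp
  have "(\<integral>\<^sup>+ x. family_max ?a q S x * ennreal (u x) \<partial>lebesgue)
      \<le> enn_powr 16 q * (\<Sum>R\<in>P. enn_powr (?a R) q * (\<integral>\<^sup>+ x\<in>R. ennreal (u x) \<partial>lebesgue))"
    using S almost_cube_imp_lmeasurable weights(1) q_pos
    by (intro nn_integral_family_max_le_principal_sum[OF _ _ P]) auto
  also have "\<dots> \<le> enn_powr 16 q * (carleson_const * enn_powr (norm1 f * norm2 g) q)"
    using P_subset S(3) finite_subset[OF P_subset S(1)] laminar_subset[OF S(2) P_subset]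
    by (intro mult_left_mono sum_bilinear_mean_le carleson f g) auto
  finally show ?thesis
    by (simp add: mult.assoc)
qed

end

subsection \<open>Shifted dyadic grids\<close>

definition grid_cube :: "'a::euclidean_space \<Rightarrow> real \<Rightarrow> ('a \<Rightarrow> int) \<Rightarrow> 'a set" where
  "grid_cube t h k = {x. \<forall>b\<in>Basis. \<lfloor>(x - t) \<bullet> b / h\<rfloor> = k b}"

lemma grid_cube_null_diff:
  fixes t :: "'a::euclidean_space" and k :: "'a \<Rightarrow> int"
  assumes mesh_pos: "0 < h"
  defines "a \<equiv> t + (\<Sum>b\<in>Basis. (h * real_of_int (k b)) *\<^sub>R b)"
  shows "grid_cube t h k \<subseteq> cbox a (a + h *\<^sub>R One)"
    and "cbox a (a + h *\<^sub>R One) - grid_cube t h k \<in> null_sets lebesgue"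
proof -
  have corner: "a \<bullet> b = t \<bullet> b + h * real_of_int (k b)" if "b \<in> Basis" for b
    using that
    by (simp add: a_def inner_add_left inner_sum_left inner_Basis if_distrib sum.delta cong: if_cong)
  have floor_eq: "\<lfloor>(x - t) \<bullet> b / h\<rfloor> = k b \<longleftrightarrow> a \<bullet> b \<le> x \<bullet> b \<and> x \<bullet> b < (a + h *\<^sub>R One) \<bullet> b"
    if "b \<in> Basis" for x b
    using that mesh_pos by (auto simp: floor_eq_iff inner_diff_left inner_add_left corner field_simps)
  show "grid_cube t h k \<subseteq> cbox a (a + h *\<^sub>R One)"
    by (fastforce simp: grid_cube_def floor_eq mem_box intro: less_imp_le)
  have "box a (a + h *\<^sub>R One) \<subseteq> grid_cube t h k"
    by (auto simp: grid_cube_def floor_eq mem_box intro: less_imp_le)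
  then have "negligible (cbox a (a + h *\<^sub>R One) - grid_cube t h k)"
    by (intro negligible_subset[OF negligible_frontier_interval]) auto
  then show "cbox a (a + h *\<^sub>R One) - grid_cube t h k \<in> null_sets lebesgue"
    by (simp add: negligible_iff_null_sets)
qed

lemma almost_cube_grid_cube: "0 < h \<Longrightarrow> almost_cube (grid_cube t h k)"
  using grid_cube_null_diff[of h t k] unfolding almost_cube_def is_cube_def by blast

lemma vol_grid_cube:
  fixes t :: "'a::euclidean_space"
  assumes "0 < h"
  shows "vol (grid_cube t h k) = h ^ DIM('a)"
proof -
  define a where "a = t + (\<Sum>b\<in>Basis. (h * real_of_int (k b)) *\<^sub>R b)"
  let ?G = "grid_cube t h k" and ?C = "cbox a (a + h *\<^sub>R One)"
  have subset: "?G \<subseteq> ?C" and null_diff: "?C - ?G \<in> null_sets lebesgue"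
    unfolding a_def by (rule grid_cube_null_diff[OF assms])+
  have "?G \<in> sets lebesgue"
    using almost_cube_imp_lmeasurable[OF almost_cube_grid_cube[OF assms]] by blast
  then have "vol (?G \<union> (?C - ?G)) = vol ?G"
    using null_diff by (rule measure_Un_null_set)
  also have "?G \<union> (?C - ?G) = ?C"
    using subset by blast
  finally show ?thesis
    by (simp only: vol_cube[OF assms])
qed

lemma grid_cube_nested:
  assumes "x \<in> grid_cube t h k" "x \<in> grid_cube t (h * 2 ^ d) k'"
  shows "grid_cube t h k \<subseteq> grid_cube t (h * 2 ^ d) k'"
proof -
  have "\<lfloor>y / (h * 2 ^ d)\<rfloor> = \<lfloor>y / h\<rfloor> div 2 ^ d" for y :: real
    using floor_divide_real_eq_div[of "2 ^ d" "y / h"] by simp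
  then show ?thesis
    using assms by (auto simp: grid_cube_def)
qed

definition grid_origin :: "nat \<Rightarrow> 'a::euclidean_space set \<Rightarrow> 'a" where
  "grid_origin N U = (2 ^ N / 3) *\<^sub>R \<Sum>U"

text \<open>Truncated in scale and position so as to be finite: every cube is covered for all large \<open>N\<close>, and Fatou's
  lemma passes to the limit.\<close>

definition grid_family :: "nat \<Rightarrow> 'a::euclidean_space set \<Rightarrow> 'a set set" where
  "grid_family N U = (\<lambda>(j, k). grid_cube (grid_origin N U) (2 ^ N / 2 ^ j) k) `
     ({..2 * N} \<times> (Basis \<rightarrow>\<^sub>E {- (2 * 4 ^ N)..2 * 4 ^ N}))"

lemma grid_origin_inner:
  assumes "U \<subseteq> Basis" "b \<in> Basis"
  shows "grid_origin N U \<bullet> b = (if b \<in> U then 2 ^ N / 3 else 0)"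
proof -
  have "\<Sum>U \<bullet> b = (\<Sum>c\<in>U. if c = b then 1 else 0)"
    unfolding inner_sum_left using assms by (intro sum.cong) (auto simp: inner_Basis)
  then show ?thesis
    using finite_subset[OF assms(1)] by (simp add: grid_origin_def)
qed

lemma finite_grid_family: "finite (grid_family N U)"
  unfolding grid_family_def by (intro finite_imageI finite_cartesian_product finite_PiE) auto

lemma almost_cube_grid_family: "Q \<in> grid_family N U \<Longrightarrow> almost_cube Q"
  by (auto simp: grid_family_def intro!: almost_cube_grid_cube)

lemma laminar_grid_family: "laminar (grid_family N U)"
proof -
  define G where "G j = grid_cube (grid_origin N U) (2 ^ N / 2 ^ j)" for j :: nat
  have nested: "G j k \<inter> G i k' = {} \<or> G j k \<subseteq> G i k'" if "i \<le> j" for i j k k'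
  proof -
    have "2 ^ j = 2 ^ i * (2::real) ^ (j - i)"
      using that by (simp flip: power_add)
    then have "2 ^ N / 2 ^ i = 2 ^ N / 2 ^ j * (2::real) ^ (j - i)"
      by simp
    then show ?thesis
      unfolding G_def using grid_cube_nested[of _ _ "2 ^ N / 2 ^ j" k "j - i" k'] by (metis disjoint_iff)
  qed
  have "G i k \<inter> G j k' = {} \<or> G i k \<subseteq> G j k' \<or> G j k' \<subseteq> G i k" for i j k k'
    using nested[of i j k' k] nested[of j i k k'] by (cases "i \<le> j") (auto simp: Int_commute)
  then show ?thesis
    unfolding laminar_def grid_family_def G_def by auto
qed

subsection \<open>The one-third trick\<close>

text \<open>At mesh \<open>2 ^ N / 2 ^ j\<close> the shift \<open>2 ^ N / 3\<close> amounts to \<open>2 ^ j / 3\<close> meshes. No power of two is divisible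
  by three, so the boundaries of the shifted and the unshifted grid are at least a third of a mesh apart.\<close>

lemma floor_eq_or_shifted_floor_eq:
  fixes a d :: real
  assumes "0 \<le> d" "d < 1 / 3"
  shows "\<lfloor>a + d\<rfloor> = \<lfloor>a\<rfloor> \<or> \<lfloor>a + d - 2 ^ j / 3\<rfloor> = \<lfloor>a - 2 ^ j / 3\<rfloor>"
proof (rule ccontr)
  assume both_differ: "\<not> ?thesis"
  define m n where "m = \<lfloor>a + d\<rfloor>" and "n = \<lfloor>a + d - 2 ^ j / 3\<rfloor>"
  have "\<lfloor>a\<rfloor> \<le> m" "\<lfloor>a - 2 ^ j / 3\<rfloor> \<le> n"
    using assms by (auto simp: m_def n_def intro!: floor_mono)
  with both_differ have "\<lfloor>a\<rfloor> < m" "\<lfloor>a - 2 ^ j / 3\<rfloor> < n"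
    by (auto simp: m_def n_def)
  then have "a < real_of_int m" "a - 2 ^ j / 3 < real_of_int n"
    by (auto simp: floor_less_iff)
  moreover have "real_of_int m \<le> a + d" "real_of_int n \<le> a + d - 2 ^ j / 3"
    by (auto simp: m_def n_def)
  ultimately have "real_of_int m - real_of_int n - 2 ^ j / 3 < 1 / 3"
      "2 ^ j / 3 - (real_of_int m - real_of_int n) < 1 / 3"
    using assms by linarith+
  then have "real_of_int (3 * (m - n) - 2 ^ j) < 1" "real_of_int (2 ^ j - 3 * (m - n)) < 1"
    by (auto simp: field_simps)
  then have "3 * (m - n) = 2 ^ j"
    by linarith
  then have "(3::int) dvd 2 ^ j"
    by (metis dvd_triv_left)
  then have "(3::int) dvd 2"
    using prime_dvd_power[of "3::int" 2 j] by simp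
  then show False
    by simp
qed

lemma cbox_subset_grid_cube:
  fixes a t :: "'a::euclidean_space"
  assumes "0 < H" "\<And>b. b \<in> Basis \<Longrightarrow> \<lfloor>((a - t) \<bullet> b + h) / H\<rfloor> = \<lfloor>(a - t) \<bullet> b / H\<rfloor>"
  shows "cbox a (a + h *\<^sub>R One) \<subseteq> grid_cube t H (\<lambda>b\<in>Basis. \<lfloor>(a - t) \<bullet> b / H\<rfloor>)"
proof
  fix x assume "x \<in> cbox a (a + h *\<^sub>R One)"
  then have x_bounds: "(a - t) \<bullet> b \<le> (x - t) \<bullet> b" "(x - t) \<bullet> b \<le> (a - t) \<bullet> b + h" if "b \<in> Basis" for b
    using that by (auto simp: mem_box inner_add_left inner_diff_left)
  have "\<lfloor>(x - t) \<bullet> b / H\<rfloor> = \<lfloor>(a - t) \<bullet> b / H\<rfloor>" if in_Basis: "b \<in> Basis" for b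
  proof (rule antisym)
    have "\<lfloor>(x - t) \<bullet> b / H\<rfloor> \<le> \<lfloor>((a - t) \<bullet> b + h) / H\<rfloor>"
      using x_bounds[OF in_Basis] assms(1) by (intro floor_mono divide_right_mono) auto
    then show "\<lfloor>(x - t) \<bullet> b / H\<rfloor> \<le> \<lfloor>(a - t) \<bullet> b / H\<rfloor>"
      using assms(2)[OF in_Basis] by simp
    show "\<lfloor>(a - t) \<bullet> b / H\<rfloor> \<le> \<lfloor>(x - t) \<bullet> b / H\<rfloor>"
      using x_bounds[OF in_Basis] assms(1) by (intro floor_mono divide_right_mono) auto
  qed
  then show "x \<in> grid_cube t H (\<lambda>b\<in>Basis. \<lfloor>(a - t) \<bullet> b / H\<rfloor>)"
    by (simp add: grid_cube_def)
qed

lemma one_third_trick: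
  fixes a :: "'a::euclidean_space"
  assumes mesh: "0 < h" "3 * h < 2 ^ N / 2 ^ j"
  obtains U where "U \<subseteq> Basis" "cbox a (a + h *\<^sub>R One) \<subseteq> grid_cube (grid_origin N U) (2 ^ N / 2 ^ j)
    (\<lambda>b\<in>Basis. \<lfloor>(a - grid_origin N U) \<bullet> b / (2 ^ N / 2 ^ j)\<rfloor>)"
proof
  define H :: real where "H = 2 ^ N / 2 ^ j"
  define U where "U = {b\<in>Basis. \<lfloor>a \<bullet> b / H + h / H\<rfloor> \<noteq> \<lfloor>a \<bullet> b / H\<rfloor>}"
  define t where "t = grid_origin N U"
  have ratio: "0 < H" "0 \<le> h / H" "h / H < 1 / 3"
    using mesh by (auto simp: H_def field_simps)
  show "U \<subseteq> Basis"
    by (simp add: U_def)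
  have "\<lfloor>((a - t) \<bullet> b + h) / H\<rfloor> = \<lfloor>(a - t) \<bullet> b / H\<rfloor>" if in_Basis: "b \<in> Basis" for b
  proof -
    have "t \<bullet> b / H = (if b \<in> U then 2 ^ j / 3 else 0)"
      using in_Basis \<open>U \<subseteq> Basis\<close> by (simp add: t_def grid_origin_inner H_def)
    then show ?thesis
      using floor_eq_or_shifted_floor_eq[OF ratio(2,3), of "a \<bullet> b / H" j] in_Basis
      by (auto simp: U_def inner_diff_left add_divide_distrib diff_divide_distrib diff_add_eq
          split: if_splits)
  qed
  then show "cbox a (a + h *\<^sub>R One) \<subseteq> grid_cube (grid_origin N U) (2 ^ N / 2 ^ j)
      (\<lambda>b\<in>Basis. \<lfloor>(a - grid_origin N U) \<bullet> b / (2 ^ N / 2 ^ j)\<rfloor>)"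
    using cbox_subset_grid_cube[OF ratio(1), of a t h] by (simp add: H_def t_def)
qed

lemma eventually_dyadic_scale:
  fixes h :: real
  assumes "0 < h"
  shows "eventually (\<lambda>N. \<exists>j\<le>2 * N. h < 2 ^ N / 2 ^ j \<and> 2 ^ N / 2 ^ j \<le> 2 * h) sequentially"
proof -
  define e where "e = \<lfloor>log 2 (2 * h)\<rfloor>"
  have "real_of_int e \<le> log 2 (2 * h)" "log 2 (2 * h) < real_of_int e + 1"
    by (auto simp: e_def)
  then have e_bounds: "2 powr e \<le> 2 * h" "2 * h < 2 powr (e + 1)"
    using assms by (auto simp: le_log_iff log_less_iff)
  have "\<exists>j\<le>2 * N. h < 2 ^ N / 2 ^ j \<and> 2 ^ N / 2 ^ j \<le> 2 * h" if "nat \<bar>e\<bar> \<le> N" for N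
  proof -
    define j where "j = nat (int N - e)"
    have j_eq: "int j = int N - e" "j \<le> 2 * N"
      using that by (auto simp: j_def)
    have "2 ^ N / 2 ^ j = (2::real) powr (real N - real j)"
      by (simp add: powr_diff powr_realpow)
    also have "real N - real j = e"
      using j_eq by linarith
    finally show ?thesis
      using e_bounds j_eq(2) by (intro exI[of _ j]) (auto simp: powr_add)
  qed
  then show ?thesis
    unfolding eventually_sequentially by blast
qed

lemma grid_cube_in_grid_family:
  fixes a :: "'a::euclidean_space"
  assumes "norm a \<le> 2 ^ N" "U \<subseteq> Basis" "j \<le> 2 * N"
  shows "grid_cube (grid_origin N U) (2 ^ N / 2 ^ j)
      (\<lambda>b\<in>Basis. \<lfloor>(a - grid_origin N U) \<bullet> b / (2 ^ N / 2 ^ j)\<rfloor>) \<in> grid_family N U"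
proof -
  define y where "y b = (a - grid_origin N U) \<bullet> b / (2 ^ N / 2 ^ j)" for b
  have "\<lfloor>y b\<rfloor> \<in> {- (2 * 4 ^ N)..2 * 4 ^ N}" if in_Basis: "b \<in> Basis" for b
  proof -
    have "\<bar>a \<bullet> b\<bar> \<le> 2 ^ N"
      using Basis_le_norm[OF in_Basis, of a] assms(1) by linarith
    then have "\<bar>(a - grid_origin N U) \<bullet> b\<bar> \<le> 2 * 2 ^ N"
      using grid_origin_inner[OF assms(2) in_Basis, of N] by (auto simp: inner_diff_left abs_le_iff)
    moreover have "(2::real) ^ j / 2 ^ N \<le> 2 ^ N"
      using assms(3) power_increasing[of j "2 * N" "2::real"]
      by (simp add: field_simps flip: power_add mult_2)
    ultimately have "\<bar>(a - grid_origin N U) \<bullet> b\<bar> * (2 ^ j / 2 ^ N) \<le> 2 * 2 ^ N * 2 ^ N"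
      by (intro mult_mono) auto
    also have "2 * 2 ^ N * 2 ^ N = 2 * (4::real) ^ N"
      by (simp flip: power_mult_distrib)
    finally have "\<bar>y b\<bar> \<le> 2 * 4 ^ N"
      by (simp add: y_def abs_mult)
    then have "- (2 * 4 ^ N) \<le> y b" "y b < 2 * 4 ^ N + 1"
      by linarith+
    then show ?thesis
      by (simp add: le_floor_iff floor_le_iff)
  qed
  then show ?thesis
    unfolding grid_family_def y_def[symmetric] using assms(3)
    by (intro image_eqI[of _ _ "(j, \<lambda>b\<in>Basis. \<lfloor>y b\<rfloor>)"]) auto
qed

lemma eventually_cube_subset_grid_family:
  fixes Q :: "'a::euclidean_space set"
  assumes "is_cube Q"
  shows "eventually (\<lambda>N. \<exists>U\<subseteq>Basis. \<exists>R\<in>grid_family N U. Q \<subseteq> R \<and> vol R \<le> 6 ^ DIM('a) * vol Q) sequentially"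
proof -
  obtain a h where side_pos: "0 < h" and Q_eq: "Q = cbox a (a + h *\<^sub>R One)"
    using assms by (auto simp: is_cube_def)
  obtain N0 :: nat where N0: "norm a < 2 ^ N0"
    using real_arch_pow[of 2 "norm a"] by auto
  have "eventually (\<lambda>N. N0 \<le> N) sequentially"
    by (rule eventually_ge_at_top)
  moreover have "eventually (\<lambda>N. \<exists>j\<le>2 * N.
      3 * h < 2 ^ N / 2 ^ j \<and> 2 ^ N / 2 ^ j \<le> 2 * (3 * h)) sequentially"
    using side_pos by (intro eventually_dyadic_scale) simp
  ultimately show ?thesis
  proof eventually_elim
    case (elim N)
    then obtain j where scale: "j \<le> 2 * N" "3 * h < 2 ^ N / 2 ^ j" "2 ^ N / 2 ^ j \<le> 6 * h"
      by auto
    obtain U where U: "U \<subseteq> Basis" "Q \<subseteq> grid_cube (grid_origin N U) (2 ^ N / 2 ^ j)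
        (\<lambda>b\<in>Basis. \<lfloor>(a - grid_origin N U) \<bullet> b / (2 ^ N / 2 ^ j)\<rfloor>)" (is "Q \<subseteq> ?R")
      using one_third_trick[OF side_pos scale(2)] unfolding Q_eq by blast
    have "norm a \<le> 2 ^ N"
      by (rule order_trans[OF less_imp_le[OF N0] power_increasing[OF elim(1)]]) simp
    then have "?R \<in> grid_family N U"
      using U(1) scale(1) by (rule grid_cube_in_grid_family)
    moreover have "vol ?R \<le> 6 ^ DIM('a) * vol Q"
    proof -
      have "vol ?R = (2 ^ N / 2 ^ j) ^ DIM('a)"
        by (rule vol_grid_cube) simp
      also have "\<dots> \<le> (6 * h) ^ DIM('a)"
        using scale(3) by (rule power_mono) simp
      also have "\<dots> = 6 ^ DIM('a) * vol Q"
        by (simp only: Q_eq vol_cube[OF side_pos] power_mult_distrib)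
      finally show ?thesis .
    qed
    ultimately show ?case
      using U by blast
  qed
qed

subsection \<open>The maximal function\<close>

definition grid_max :: "('a::euclidean_space set \<Rightarrow> ennreal) \<Rightarrow> real \<Rightarrow> nat \<Rightarrow> 'a \<Rightarrow> ennreal" where
  "grid_max a q N x = (\<Sum>U\<in>Pow Basis. family_max a q (grid_family N U) x)"

lemma borel_measurable_grid_family_max: "family_max a q (grid_family N U) \<in> borel_measurable lebesgue"
  using almost_cube_imp_lmeasurable[OF almost_cube_grid_family]
  by (intro borel_measurable_family_max finite_grid_family) blast

lemma nn_integral_grid_max_le:
  fixes a :: "'a::euclidean_space set \<Rightarrow> ennreal"
  assumes measurable_w [measurable]: "w \<in> borel_measurable lebesgue"
    and family_bound: "\<And>U. (\<integral>\<^sup>+ x. family_max a q (grid_family N U) x * w x \<partial>lebesgue) \<le> B"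
  shows "(\<integral>\<^sup>+ x. grid_max a q N x * w x \<partial>lebesgue) \<le> 2 ^ DIM('a) * B"
proof -
  note [measurable] = borel_measurable_grid_family_max
  have "(\<integral>\<^sup>+ x. grid_max a q N x * w x \<partial>lebesgue)
      = (\<Sum>U\<in>Pow Basis. \<integral>\<^sup>+ x. family_max a q (grid_family N U) x * w x \<partial>lebesgue)"
    unfolding grid_max_def sum_distrib_right by (rule nn_integral_sum) measurable
  also have "\<dots> \<le> (\<Sum>U\<in>Pow (Basis :: 'a set). B)"
    by (intro sum_mono family_bound)
  finally show ?thesis
    by (simp add: card_Pow)
qed

lemma eventually_bilinear_mean_powr_le_grid_max:
  fixes f g :: "'a::euclidean_space \<Rightarrow> real"
  assumes exponents: "0 \<le> \<alpha>" "1 \<le> r" "1 \<le> s" "0 \<le> q" and Q: "is_cube Q" "x \<in> Q"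
  shows "eventually (\<lambda>N. enn_powr (bilinear_mean \<alpha> r s f g Q) q
    \<le> enn_powr (36 ^ DIM('a)) q * grid_max (bilinear_mean \<alpha> r s f g) q N x) sequentially"
  using eventually_cube_subset_grid_family[OF Q(1)]
proof eventually_elim
  case (elim N)
  let ?a = "bilinear_mean \<alpha> r s f g"
  obtain U R where enlarged: "U \<subseteq> Basis" "R \<in> grid_family N U" "Q \<subseteq> R" "vol R \<le> 6 ^ DIM('a) * vol Q"
    using elim by blast
  have "?a Q \<le> ennreal (6 ^ DIM('a) * 6 ^ DIM('a)) * ?a R"
    using enlarged(3,4) exponents is_cube_lmeasurable[OF Q(1)] is_cube_vol_pos[OF Q(1)]
      almost_cube_imp_lmeasurable[OF almost_cube_grid_family[OF enlarged(2)]]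
    by (intro bilinear_mean_le_enlarged) auto
  also have "ennreal (6 ^ DIM('a) * 6 ^ DIM('a)) = 36 ^ DIM('a)"
    by (simp flip: power_mult_distrib ennreal_power)
  finally have "enn_powr (?a Q) q \<le> enn_powr (36 ^ DIM('a)) q * enn_powr (?a R) q"
    unfolding enn_powr_mult[symmetric] using exponents(4) by (rule enn_powr_mono)
  also have "enn_powr (?a R) q = enn_powr (?a R) q * indicator R x"
    using enlarged(3) Q(2) by auto
  also have "\<dots> \<le> family_max ?a q (grid_family N U) x"
    unfolding family_max_def using enlarged(2) by (rule SUP_upper)
  also have "\<dots> \<le> grid_max ?a q N x"
    unfolding grid_max_def using enlarged(1) by (intro member_le_sum) auto
  finally show ?case
    by (simp add: mult_left_mono)
qed

lemma nn_integral_frac_max_powr_le: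
  fixes f g :: "'a::euclidean_space \<Rightarrow> real"
  assumes exponents: "0 \<le> \<alpha>" "1 \<le> r" "1 \<le> s" "0 < q" and measurable_w [measurable]: "w \<in> borel_measurable lebesgue"
    and family_bound: "\<And>N U.
      (\<integral>\<^sup>+ x. family_max (bilinear_mean \<alpha> r s f g) q (grid_family N U) x * w x \<partial>lebesgue) \<le> B"
  shows "(\<integral>\<^sup>+ x. enn_powr (frac_max \<alpha> r s f g x) q * w x \<partial>lebesgue)
    \<le> enn_powr (36 ^ DIM('a)) q * (2 ^ DIM('a) * B)"
proof -
  define K where "K = enn_powr (36 ^ DIM('a)) q"
  let ?a = "bilinear_mean \<alpha> r s f g"
  note [measurable] = borel_measurable_grid_family_max
  have [measurable]: "grid_max ?a q N \<in> borel_measurable lebesgue" for N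
    unfolding grid_max_def[abs_def] by measurable
  have "enn_powr (frac_max \<alpha> r s f g x) q * w x \<le> liminf (\<lambda>N. K * (grid_max ?a q N x * w x))" for x
  proof -
    have "enn_powr (frac_max \<alpha> r s f g x) q * w x \<le> (SUP Q\<in>{Q. is_cube Q \<and> x \<in> Q}. enn_powr (?a Q) q) * w x"
      unfolding frac_max_eq_SUP_bilinear_mean using exponents
      by (intro mult_right_mono enn_powr_SUP_le) auto
    also have "\<dots> = (SUP Q\<in>{Q. is_cube Q \<and> x \<in> Q}. enn_powr (?a Q) q * w x)"
      by (rule SUP_mult_right_ennreal)
    also have "\<dots> \<le> liminf (\<lambda>N. K * (grid_max ?a q N x * w x))"
    proof (intro SUP_least Liminf_bounded)
      fix Q assume "Q \<in> {Q. is_cube Q \<and> x \<in> Q}"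
      then have "eventually (\<lambda>N. enn_powr (?a Q) q \<le> K * grid_max ?a q N x) sequentially"
        unfolding K_def using exponents by (intro eventually_bilinear_mean_powr_le_grid_max) auto
      then show "eventually (\<lambda>N. enn_powr (?a Q) q * w x \<le> K * (grid_max ?a q N x * w x)) sequentially"
        unfolding mult.assoc[symmetric] by eventually_elim (rule mult_right_mono; simp)
    qed
    finally show ?thesis .
  qed
  then have "(\<integral>\<^sup>+ x. enn_powr (frac_max \<alpha> r s f g x) q * w x \<partial>lebesgue)
      \<le> (\<integral>\<^sup>+ x. liminf (\<lambda>N. K * (grid_max ?a q N x * w x)) \<partial>lebesgue)"
    by (rule nn_integral_mono)
  also have "\<dots> \<le> liminf (\<lambda>N. \<integral>\<^sup>+ x. K * (grid_max ?a q N x * w x) \<partial>lebesgue)"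
    by (rule nn_integral_liminf) measurable
  also have "\<dots> \<le> liminf (\<lambda>N::nat. K * (2 ^ DIM('a) * B))"
    using nn_integral_grid_max_le[OF measurable_w family_bound]
    by (intro Liminf_mono always_eventually allI) (simp add: nn_integral_cmult mult_left_mono)
  also have "\<dots> = K * (2 ^ DIM('a) * B)"
    by (simp add: Liminf_const)
  finally show ?thesis
    by (simp add: K_def)
qed

definition (in bump_weights) maximal_const :: ennreal where
  "maximal_const
     = enn_powr (enn_powr (36 ^ DIM('a)) q * (2 ^ DIM('a) * (enn_powr 16 q * carleson_const))) (1 / q)"

lemma (in bump_weights) maximal_const_finite: "maximal_const < \<infinity>"
  using carleson_const_finite
  by (simp add: maximal_const_def ennreal_mult_eq_top_iff power_eq_top_ennreal less_top[symmetric])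

theorem (in bump_weights) wnorm_frac_max_le:
  assumes f: "f \<in> borel_measurable lebesgue" "norm1 f < \<infinity>"
    and g: "g \<in> borel_measurable lebesgue" "norm2 g < \<infinity>"
  shows "wnorm u q (frac_max \<alpha> r s f g) \<le> maximal_const * (norm1 f * norm2 g)"
proof -
  define B where "B = enn_powr 16 q * carleson_const * enn_powr (norm1 f * norm2 g) q"
  have "(\<integral>\<^sup>+ x. enn_powr (frac_max \<alpha> r s f g x) q * ennreal (u x) \<partial>lebesgue)
      \<le> enn_powr (36 ^ DIM('a)) q * (2 ^ DIM('a) * B)"
    unfolding B_def using \<alpha> r s q_pos weights(1)
    by (intro nn_integral_frac_max_powr_le nn_integral_family_max_le finite_grid_family laminar_grid_family
        almost_cube_grid_family f g) auto
  then have "wnorm u q (frac_max \<alpha> r s f g)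
      \<le> enn_powr (enn_powr (36 ^ DIM('a)) q * (2 ^ DIM('a) * B)) (1 / q)"
    unfolding wnorm_def using q_pos by (intro enn_powr_mono) auto
  then show ?thesis
    using q_pos by (simp add: maximal_const_def B_def enn_powr_mult enn_powr_powr mult_ac)
qed

theorem theorem6p2:
  fixes \<alpha> r s p1 p2 p q :: real
    and u v1 v2 :: "'a::euclidean_space \<Rightarrow> real"
    and \<phi>1 \<phi>2 :: "real \<Rightarrow> real"
  assumes "0 \<le> \<alpha>" "\<alpha> < real DIM('a)"
    and "1 < r" "r < p1" "1 < s" "s < p2"
    and "p = p1 * p2 / (p1 + p2)" "r * s / (r + s) < p" "p \<le> q"
    and "\<phi>1 \<in> Y_class r (B_class p1 (p1 * q / p))"
    and "\<phi>2 \<in> Y_class s (B_class p2 (p2 * q / p))"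
    and "(u, v1, v2) \<in> A_class \<alpha> p1 p2 q \<phi>1 \<phi>2"
  shows "\<exists>C::real. C > 0 \<and>
    (\<forall>f g. f \<in> borel_measurable lebesgue \<longrightarrow> g \<in> borel_measurable lebesgue \<longrightarrow>
       wnorm v1 p1 (\<lambda>x. ennreal \<bar>f x\<bar>) < \<infinity> \<longrightarrow> wnorm v2 p2 (\<lambda>x. ennreal \<bar>g x\<bar>) < \<infinity> \<longrightarrow>
       wnorm u q (frac_max \<alpha> r s f g)
         \<le> ennreal C * wnorm v1 p1 (\<lambda>x. ennreal \<bar>f x\<bar>) * wnorm v2 p2 (\<lambda>x. ennreal \<bar>g x\<bar>))"
proof -
  obtain \<Psi>1 \<Psi>2 where "young_pair r \<phi>1 \<Psi>1" "\<Psi>1 \<in> B_class p1 (p1 * q / p)"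
      and "young_pair s \<phi>2 \<Psi>2" "\<Psi>2 \<in> B_class p2 (p2 * q / p)"
    using assms(10,11) by (meson Y_classE)
  then interpret bump_weights \<alpha> r s p1 p2 p q u v1 v2 \<phi>1 \<phi>2 \<Psi>1 \<Psi>2
    using assms by unfold_locales auto
  define C where "C = enn2real maximal_const + 1"
  have "0 < C"
    by (simp add: C_def add_nonneg_pos)
  moreover have "maximal_const \<le> ennreal C"
    using maximal_const_finite by (cases maximal_const) (auto simp: C_def ennreal_leI)
  then have "wnorm u q (frac_max \<alpha> r s f g) \<le> ennreal C * norm1 f * norm2 g"
    if "f \<in> borel_measurable lebesgue" "norm1 f < \<infinity>" "g \<in> borel_measurable lebesgue" "norm2 g < \<infinity>" for f g
    using order_trans[OF wnorm_frac_max_le[OF that] mult_right_mono] by (simp add: mult.assoc)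
  ultimately show ?thesis
    by blast
qed

end
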